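(* Let $n\ge 1$ and $N\ge 1$ be integers. There exist points $\lambda_1,\dots,\lambda_{N^n}\in\mathbb{D}^n$ with the following property: (P) for each $f\in\mathcal{I}_N(\mathbb{D}^n)$, if $g\in\mathcal{S}(\mathbb{D}^n)$ satisfies $g(\lambda_i)=f(\lambda_i)$ for $i=1,\dots,N^n$, then $g=f$ on $\mathbb{D}^n$. Furthermore, the points may be chosen as follows. Let $M=N^{n-1}$. For each $r=2,\dots,n$ let $\tau_1^r,\dots,\tau_N^r\in\mathbb{T}$ be distinct, and let $D_1,\dots,D_M$ be the $M$ distinct analytic discs given by $$D_k:\mathbb{D}\to\mathbb{D}^n,\qquad D_k(z)=(z,\tau^2_{i_{2,k}}z,\dots,\tau^n_{i_{n,k}}z),$$ where $i_{r,k}\in\{1,\dots,N\}$ (so that, as $k$ runs over $1,\dots,M$, the index tuple $(i_{2,k},\dots,i_{n,k})$ runs over all of $\{1,\dots,N\}^{n-1}$). If for each $k=1,\dots,M$ the points $\lambda_{k_1},\dots,\lambda_{k_N}\in D_k(\mathbb{D})$ are distinct, then the family of points $\{\lambda_{k_j}\}$, $k=1,\dots,M$, $j=1,\dots,N$, has property (P); that is, for each $f\in\mathcal{I}_N(\mathbb{D}^n)$, if $g\in\mathcal{S}(\mathbb{D}^n)$ satisfies $g(\lambda_{k_j})=f(\lambda_{k_j})$ for all $k$ and $j$, then $g=f$ on $\mathbb{D}^n$.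
   Context: $\mathbb{D}$ is the open unit disc in $\mathbb{C}$, $\mathbb{T}=\partial\mathbb{D}$, and $\mathbb{D}^n,\mathbb{T}^n\subset\mathbb{C}^n$ are the $n$-fold cartesian products. A rational function $f$ on $\mathbb{D}^n$ is called inner if $f$ is analytic on $\mathbb{D}^n$ and $|f(\tau)|=1$ for almost every $\tau\in\mathbb{T}^n$. For a rational function $f=q/r$ with $q,r\in\mathbb{C}[z_1,\dots,z_n]$ relatively prime, the degree of $f$ is the (total) degree of the numerator $q$. $\mathcal{I}_N(\mathbb{D}^n)$ is the set of rational inner functions on $\mathbb{D}^n$ of degree strictly less than $N$. The Schur class $\mathcal{S}(\mathbb{D}^n)$ is the set of analytic functions mapping $\mathbb{D}^n$ to $\mathbb{D}$. *)

theory Defs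
  imports "HOL-Analysis.Analysis" "HOL-Library.Poly_Mapping"
begin

text \<open>Points of $n$-dimensional complex space are vectors of type \<^typ>\<open>complex ^ 'n\<close>, where
  $n$ is the cardinality of the finite type \<^typ>\<open>'n\<close>.\<close>

definition polydisc :: "(complex ^ 'n) set" where
  "polydisc = {z. \<forall>i. z $ i \<in> ball 0 1}"

text \<open>Lebesgue measure on the $n$-torus, carried over from angles; it is not normalised, which is
  irrelevant for null sets.\<close>

definition torus_measure :: "(complex ^ 'n) measure" where
  "torus_measure =
     distr (restrict_space lborel {\<theta> :: real ^ 'n. \<forall>i. 0 \<le> \<theta> $ i \<and> \<theta> $ i < 2 * pi})
       borel (\<lambda>\<theta>. \<chi> i. cis (\<theta> $ i))"

text \<open>Analyticity in several variables, as complex Frechet differentiability: at every point of the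
  (open) set there is a real derivative which is moreover complex linear.\<close>

definition analytic_several_on :: "(complex ^ 'n \<Rightarrow> complex) \<Rightarrow> (complex ^ 'n) set \<Rightarrow> bool" where
  "analytic_several_on f U \<longleftrightarrow>
     (\<forall>z\<in>U. \<exists>f'. (f has_derivative f') (at z) \<and> (\<forall>c v. f' (c *s v) = c * f' v))"

text \<open>Polynomials in variables indexed by \<^typ>\<open>'n\<close>: finitely supported maps from exponent
  vectors to coefficients, with the ring structure from \<^theory>\<open>HOL-Library.Poly_Mapping\<close>.\<close>

type_synonym 'n cpoly = "('n \<Rightarrow>\<^sub>0 nat) \<Rightarrow>\<^sub>0 complex"

definition cpoly_eval :: "('n::finite) cpoly \<Rightarrow> complex ^ 'n \<Rightarrow> complex" where
  "cpoly_eval p z =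
     (\<Sum>m\<in>Poly_Mapping.keys p. Poly_Mapping.lookup p m * (\<Prod>i\<in>UNIV. z $ i ^ Poly_Mapping.lookup m i))"

definition total_degree :: "('n::finite) cpoly \<Rightarrow> nat" where
  "total_degree p =
     Max (insert 0 ((\<lambda>m. \<Sum>i\<in>UNIV. Poly_Mapping.lookup m i) ` Poly_Mapping.keys p))"

text \<open>The library constant \<^const>\<open>coprime\<close> needs a type class that polynomials of type
  \<open>'n cpoly\<close> are not an instance of; this is its defining formula.\<close>

definition relatively_prime :: "('n::finite) cpoly \<Rightarrow> 'n cpoly \<Rightarrow> bool" where
  "relatively_prime q r \<longleftrightarrow> (\<forall>d. d dvd q \<longrightarrow> d dvd r \<longrightarrow> d dvd 1)"

text \<open>The function \<open>f\<close> is the rational function $q/r$ in lowest terms. Its values on the zero set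
  of \<open>r\<close> are left open here; inside the polydisc they are fixed by continuity once \<open>f\<close> is
  analytic there, and on the torus that zero set is null.\<close>

definition reduced_fraction :: "(complex ^ 'n \<Rightarrow> complex) \<Rightarrow> ('n::finite) cpoly \<Rightarrow> 'n cpoly \<Rightarrow> bool" where
  "reduced_fraction f q r \<longleftrightarrow>
     r \<noteq> 0 \<and> relatively_prime q r \<and>
     (\<forall>z. cpoly_eval r z \<noteq> 0 \<longrightarrow> f z = cpoly_eval q z / cpoly_eval r z)"

definition inner_function :: "(complex ^ 'n \<Rightarrow> complex) \<Rightarrow> bool" where
  "inner_function f \<longleftrightarrow>
     analytic_several_on f polydisc \<and> (AE \<tau> in torus_measure. norm (f \<tau>) = 1)"

text \<open>Rational inner functions of degree less than \<open>N\<close>. The reduced fraction is unique up to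
  a common unit factor, so the degree does not depend on the choice of \<open>q\<close> and \<open>r\<close>.\<close>

definition rational_inner :: "nat \<Rightarrow> (complex ^ 'n \<Rightarrow> complex) set" where
  "rational_inner N =
     {f. inner_function f \<and> (\<exists>q r. reduced_fraction f q r \<and> total_degree q < N)}"

definition schur_class :: "(complex ^ 'n \<Rightarrow> complex) set" where
  "schur_class = {g. analytic_several_on g polydisc \<and> g ` polydisc \<subseteq> ball 0 1}"

text \<open>The points \<open>p i\<close>, \<open>i \<in> I\<close>, form an indexed family and need not be distinct.\<close>

definition determining :: "nat \<Rightarrow> 'i set \<Rightarrow> ('i \<Rightarrow> complex ^ 'n) \<Rightarrow> bool" where
  "determining N I p \<longleftrightarrow>
     (\<forall>f\<in>rational_inner N. \<forall>g\<in>schur_class.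
        (\<forall>i\<in>I. g (p i) = f (p i)) \<longrightarrow> (\<forall>z\<in>polydisc. g z = f z))"

text \<open>The disc $z \mapsto (z, \tau_2 z, \dots, \tau_n z)$. The coordinate \<open>a\<close> plays the role of
  the first one, as a finite index type has no designated first element; \<open>t a\<close> is ignored.\<close>

definition analytic_disc :: "'n \<Rightarrow> ('n \<Rightarrow> complex) \<Rightarrow> complex \<Rightarrow> complex ^ 'n" where
  "analytic_disc a t z = (\<chi> r. if r = a then z else t r * z)"

end

theory Submission
  imports Defs "HOL-Complex_Analysis.Conformal_Mappings"
begin

text \<open>For \<open>w\<close> on the torus, the slice \<open>z \<mapsto> f (z w)\<close> of a rational inner function of degree
  below \<open>N\<close> is a quotient \<open>q / r\<close> of one-variable polynomials with \<open>degree q < N\<close> and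
  \<open>\<bar>q\<bar> = \<bar>r\<bar>\<close> on the circle. Such a slice is determined among functions bounded by one by
  its values at \<open>N\<close> points, multiplicities allowed: if \<open>G r - q = \<Lambda> \<psi>\<close> with \<open>\<Lambda>\<close> the monic
  polynomial vanishing at the \<open>N\<close> nodes, then the mean of \<open>\<bar>\<psi>\<bar>\<^sup>2\<close> over the circle of radius
  \<open>\<rho>\<close> is at most that of \<open>(\<bar>r\<bar>\<^sup>2 - \<bar>q\<bar>\<^sup>2) / \<bar>\<Lambda>\<bar>\<^sup>2\<close>, because the cross term
  \<open>\<psi> cnj (q / \<Lambda>)\<close> agrees on that circle with a holomorphic function vanishing at 0; let \<open>\<rho>\<close> tend to 1.

  Hence \<open>g = f\<close> on the grid discs. Now free the torus coordinates one at a time. If \<open>g - f\<close> vanishes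
  on the discs with \<open>N\<close> distinct values of one coordinate, then by the Schwarz lemma in that coordinate
  it is \<open>O(\<bar>z\<bar>\<^sup>N)\<close> on every disc with that coordinate arbitrary, and the one-variable
  result with all nodes at 0 applies. So \<open>g = f\<close> on all tori of equal radii, and then everywhere.\<close>

subsection \<open>Rigidity in one variable\<close>

text \<open>Over the angle, the integrand can be compared pointwise with real functions of
  \<open>\<theta>\<close>. The case \<open>w = 0\<close> is the mean value property; general
  \<open>w\<close> recovers an interior value from the circle.\<close>

lemma Cauchy_formula_has_integral_angle:
  fixes F :: "complex \<Rightarrow> complex"
  assumes "continuous_on (cball 0 \<rho>) F" "F holomorphic_on ball 0 \<rho>" "0 < \<rho>" "norm w < \<rho>"
  shows "((\<lambda>\<theta>. F (\<rho> * cis \<theta>) * (\<rho> * cis \<theta>) / (\<rho> * cis \<theta> - w)) has_integral 2 * pi * F w) {0..2*pi}"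
proof -
  have "((\<lambda>u. F u / (u - w)) has_contour_integral (2 * pi * \<i> * F w)) (circlepath 0 \<rho>)"
    using Cauchy_integral_circlepath[of 0 \<rho> F w] assms by simp
  then have "((\<lambda>t. F (0 + \<rho> * cis t) / (0 + \<rho> * cis t - w) * \<rho> * \<i> * cis t)
      has_integral 2 * pi * \<i> * F w) {0..2*pi}"
    unfolding circlepath_def by (subst (asm) has_contour_integral_part_circlepath_iff) auto
  then have "((\<lambda>t. (F (0 + \<rho> * cis t) / (0 + \<rho> * cis t - w) * \<rho> * \<i> * cis t) * (- \<i>))
      has_integral (2 * pi * \<i> * F w) * (- \<i>)) {0..2*pi}"
    by (rule has_integral_mult_left)
  then show ?thesis
    by (simp add: mult_ac)
qed

text \<open>The points of \<open>S\<close> are distinct, so the product of the factors already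
  removed is nonzero at the next zero; the quotient must vanish there and can be divided
  again.\<close>

lemma holomorphic_factor_zeros:
  fixes F :: "complex \<Rightarrow> complex"
  assumes "finite S" "S \<subseteq> A" "open A" "F holomorphic_on A" "\<And>a. a \<in> S \<Longrightarrow> F a = 0"
  obtains H where "H holomorphic_on A" "\<And>z. z \<in> A \<Longrightarrow> F z = (\<Prod>a\<in>S. z - a) * H z"
proof -
  have "\<exists>H. H holomorphic_on A \<and> (\<forall>z\<in>A. F z = (\<Prod>a\<in>S. z - a) * H z)"
    using assms
  proof (induction S rule: finite_induct)
    case empty
    then show ?case by auto
  next
    case (insert b S)
    then obtain H where H: "H holomorphic_on A" "\<forall>z\<in>A. F z = (\<Prod>a\<in>S. z - a) * H z"
      by auto
    have b: "b \<in> A" "F b = 0" using insert by auto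
    have "(\<Prod>a\<in>S. b - a) \<noteq> 0"
      using insert by auto
    then have Hb: "H b = 0" using H(2) b by force
    \<comment> \<open>The derivative fills the removable singularity of the difference quotient at
      \<open>b\<close>.\<close>
    define K where "K = (\<lambda>z. if z = b then deriv H b else (H z - H b) / (z - b))"
    have "K holomorphic_on A"
      unfolding K_def by (rule pole_lemma_open) (use H insert in auto)
    moreover have "H z = (z - b) * K z" for z
      using Hb by (auto simp: K_def)
    ultimately show ?case
      using H insert by (intro exI[of _ K]) (auto simp: mult_ac)
  qed
  then show ?thesis using that by blast
qed

text \<open>\<open>G\<close> will be a slice of \<open>g\<close>, and \<open>q / r\<close> one of
  \<open>f\<close>. The relation is multiplied through by \<open>r\<close>, so zeros of
  \<open>r\<close> do no harm, and a value repeated in \<open>\<kappa>\<close> is a node with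
  multiplicity.\<close>

lemma inner_rigidity:
  fixes q r :: "complex poly" and G \<psi> :: "complex \<Rightarrow> complex"
  assumes deg: "degree q < card I"
    and bdry: "\<And>z. norm z = 1 \<Longrightarrow> norm (poly q z) = norm (poly r z)"
    and G: "\<And>z. norm z < 1 \<Longrightarrow> norm (G z) \<le> 1"
    and \<psi>: "\<psi> holomorphic_on ball 0 1"
    and nodes: "\<And>i. i \<in> I \<Longrightarrow> norm (\<kappa> i) < 1"
    and eq: "\<And>z. norm z < 1 \<Longrightarrow> G z * poly r z - poly q z = (\<Prod>i\<in>I. z - \<kappa> i) * \<psi> z"
    and w: "norm w < 1"
  shows "\<psi> w = 0"
proof -
  have finI: "finite I" using deg by (metis card.infinite not_less_zero)
  define N where "N = card I"
  define \<Lambda> where "\<Lambda> = (\<lambda>z. \<Prod>i\<in>I. z - \<kappa> i)"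
  \<comment> \<open>The closed annulus between the radii \<open>s\<close> and 1 contains no node,
    and circles of radius at least \<open>s\<close> stay at distance at least
    \<open>(1 - norm w) / 2\<close> from \<open>w\<close>.\<close>
  define s where "s = Max (insert ((1 + norm w) / 2) ((\<lambda>i. (1 + norm (\<kappa> i)) / 2) ` I))"
  have s_less: "s < 1" using nodes w finI by (auto simp: s_def)
  have "(1 + norm w) / 2 \<le> s" unfolding s_def by (rule Max_ge) (use finI in auto)
  then have s_w: "1 + norm w \<le> 2 * s" by simp
  have s_node: "norm (\<kappa> i) < s" if "i \<in> I" for i
  proof -
    have "(1 + norm (\<kappa> i)) / 2 \<le> s" unfolding s_def by (rule Max_ge) (use finI that in auto)
    then show ?thesis using nodes[OF that] by (simp add: field_simps)
  qed
  have s_pos: "0 < s" using s_w norm_ge_zero[of w] by linarith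
  have \<Lambda>0: "\<Lambda> z \<noteq> 0" if "s \<le> norm z" for z
    using that s_node finI by (force simp: \<Lambda>_def)
  \<comment> \<open>This will bound the mean of the square of \<open>norm \<psi>\<close>. It is 0 on
    the unit circle by \<open>bdry\<close>, and continuous where the radius is at least
    \<open>s\<close>.\<close>
  define \<phi> where "\<phi> = (\<lambda>z. ((norm (poly r z))\<^sup>2 - (norm (poly q z))\<^sup>2) / (norm (\<Lambda> z))\<^sup>2)"
  have cont\<psi>: "continuous_on (ball 0 1) \<psi>"
    using \<psi> by (rule holomorphic_on_imp_continuous_on)

  \<comment> \<open>A bound for \<open>\<phi>\<close> on one circle bounds the mean of the square of
    \<open>norm \<psi>\<close> there, and so the value at \<open>w\<close>.\<close>
  have circle: "(norm (\<psi> w))\<^sup>2 \<le> \<epsilon> * (2 / (1 - norm w))"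
    if \<rho>: "s \<le> \<rho>" "\<rho> < 1" and \<epsilon>: "\<And>\<theta>. \<phi> (\<rho> * cis \<theta>) \<le> \<epsilon>" for \<rho> \<epsilon>
  proof -
    have \<rho>0: "0 < \<rho>" using \<rho> s_pos by linarith
    have nz: "norm (\<rho> * cis \<theta>) = \<rho>" for \<theta> using \<rho>0 by (simp add: norm_mult)
    \<comment> \<open>\<open>Q\<close> and \<open>P\<close> are the reflections of \<open>q\<close> and \<open>\<Lambda>\<close>, from \<open>cnj z = \<rho>\<^sup>2 / z\<close> on the circle; as
      \<open>degree q < N\<close>, a factor \<open>z\<close> remains and \<open>K\<close> has mean 0\<close>
    define Q where "Q = (\<lambda>z. \<Sum>j<N. cnj (coeff q j) * \<rho>^(2*j) * z^(N - 1 - j))"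
    define P where "P = (\<lambda>z. \<Prod>i\<in>I. \<rho>\<^sup>2 - cnj (\<kappa> i) * z)"
    define K where "K = (\<lambda>z. \<psi> z * (z * Q z) / P z)"
    have cnjz: "cnj z = \<rho>\<^sup>2 / z" if "norm z = \<rho>" for z :: complex
    proof -
      have "z * cnj z = \<rho>\<^sup>2" using that complex_norm_square[of z] by simp
      then show ?thesis using that \<rho>0 by (auto simp: field_simps)
    qed
    \<comment> \<open>The zeros of \<open>P\<close> are the reflections of the nonzero nodes in the
      circle of radius \<open>\<rho>\<close>, hence outside the closed disc.\<close>
    have P0: "P z \<noteq> 0" if "norm z \<le> \<rho>" for z
    proof -
      have "\<rho>\<^sup>2 - cnj (\<kappa> i) * z \<noteq> 0" if i: "i \<in> I" for i
      proof
        assume "\<rho>\<^sup>2 - cnj (\<kappa> i) * z = 0"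
        then have "norm (complex_of_real (\<rho>\<^sup>2)) = norm (cnj (\<kappa> i) * z)" by simp
        then have "\<rho>\<^sup>2 = norm (\<kappa> i) * norm z" by (simp add: norm_mult norm_power)
        also have "\<dots> \<le> norm (\<kappa> i) * \<rho>" using that \<open>norm z \<le> \<rho>\<close> by (intro mult_left_mono) auto
        also have "\<dots> < \<rho> * \<rho>" using s_node[OF i] \<rho> \<rho>0 by (intro mult_strict_right_mono) auto
        finally show False by (simp add: power2_eq_square)
      qed
      then show ?thesis using finI by (auto simp: P_def)
    qed
    have Kz: "K z = \<psi> z * cnj (poly q z) / cnj (\<Lambda> z)" if z: "norm z = \<rho>" for z
    proof -
      have z0: "z \<noteq> 0" using z \<rho>0 by auto
      have "poly q z = (\<Sum>j<N. coeff q j * z ^ j)"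
        unfolding poly_altdef using deg
        by (intro sum.mono_neutral_left) (auto simp: N_def coeff_eq_0)
      then have "z ^ N * cnj (poly q z) = (\<Sum>j<N. cnj (coeff q j) * (z ^ N * (\<rho>\<^sup>2 / z) ^ j))"
        by (simp add: cnjz[OF z] sum_distrib_left mult_ac)
      \<comment> \<open>From \<open>j < N\<close>, the exponent \<open>N - 1 - j\<close> is a true
        difference and one factor \<open>z\<close> can be split off.\<close>
      also have "\<dots> = (\<Sum>j<N. z * (cnj (coeff q j) * \<rho>^(2*j) * z^(N - 1 - j)))"
      proof (rule sum.cong)
        fix j assume "j \<in> {..<N}"
        then have "N = Suc (N - 1 - j) + j" by simp
        then have "z ^ N = z * z ^ (N - 1 - j) * z ^ j" by (metis power_Suc power_add)
        then show "cnj (coeff q j) * (z ^ N * (\<rho>\<^sup>2 / z) ^ j) = z * (cnj (coeff q j) * \<rho>^(2*j) * z^(N - 1 - j))"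
          using z0 by (simp add: power_divide power_mult)
      qed simp
      also have "\<dots> = z * Q z" by (simp add: Q_def sum_distrib_left)
      finally have 1: "z ^ N * cnj (poly q z) = z * Q z" .
      have "P z = (\<Prod>i\<in>I. z * (cnj z - cnj (\<kappa> i)))"
        unfolding P_def by (rule prod.cong) (use z0 in \<open>auto simp: cnjz[OF z] algebra_simps\<close>)
      then have 2: "P z = z ^ N * cnj (\<Lambda> z)"
        by (simp add: \<Lambda>_def prod.distrib N_def)
      show ?thesis unfolding K_def 1[symmetric] 2 using z0 by simp
    qed
    have contc: "continuous_on {0..2*pi} (\<lambda>\<theta>. \<psi> (\<rho> * cis \<theta>))"
      by (rule continuous_on_compose2[OF cont\<psi>]) (use \<rho> \<rho>0 in \<open>auto intro!: continuous_intros simp: norm_mult\<close>)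
    have Kint: "((\<lambda>\<theta>. K (\<rho> * cis \<theta>)) has_integral 0) {0..2*pi}"
    proof -
      have contK: "continuous_on (cball 0 \<rho>) K"
        unfolding K_def Q_def
        by (intro continuous_intros continuous_on_subset[OF cont\<psi>])
           (use P0 \<rho> in \<open>auto simp: P_def intro!: continuous_intros\<close>)
      have "K holomorphic_on ball 0 \<rho>"
        unfolding K_def Q_def
        by (intro holomorphic_intros holomorphic_on_subset[OF \<psi>])
           (use P0 \<rho> in \<open>auto simp: P_def intro!: holomorphic_intros\<close>)
      from Cauchy_formula_has_integral_angle[OF contK this \<rho>0, of 0]
      show ?thesis using \<rho>0 by (simp add: K_def)
    qed
    \<comment> \<open>Expanding the square of \<open>norm (u + \<psi> z)\<close>, with
      \<open>u\<close> the quotient of \<open>q\<close> by \<open>\<Lambda>\<close>, produces the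
      cross term \<open>2 * Re (K z)\<close>, whose integral over the circle is 0.\<close>
    have ptw: "(norm (\<psi> (\<rho> * cis \<theta>)))\<^sup>2 \<le> \<epsilon> - 2 * Re (K (\<rho> * cis \<theta>))" for \<theta>
    proof -
      define z where "z = \<rho> * cis \<theta>"
      have z: "norm z = \<rho>" unfolding z_def using nz .
      have \<Lambda>z: "\<Lambda> z \<noteq> 0" using \<Lambda>0 z \<rho> by simp
      have "G z * poly r z = poly q z + \<Lambda> z * \<psi> z" 
        using eq[of z] z \<rho> by (simp add: \<Lambda>_def algebra_simps)
      moreover have "norm (G z * poly r z) \<le> norm (poly r z)"
        using G[of z] z \<rho> by (simp add: norm_mult mult_left_le_one_le)
      ultimately have le: "(norm (poly q z + \<Lambda> z * \<psi> z))\<^sup>2 \<le> (norm (poly r z))\<^sup>2"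
        by (metis norm_ge_zero power_mono)
      define u where "u = poly q z / \<Lambda> z"
      have "poly q z + \<Lambda> z * \<psi> z = \<Lambda> z * (u + \<psi> z)" using \<Lambda>z by (simp add: u_def field_simps)
      then have "(norm (\<Lambda> z))\<^sup>2 * (norm (u + \<psi> z))\<^sup>2 \<le> (norm (poly r z))\<^sup>2"
        using le by (simp add: norm_mult power_mult_distrib)
      then have "(norm (u + \<psi> z))\<^sup>2 \<le> (norm (poly r z))\<^sup>2 / (norm (\<Lambda> z))\<^sup>2"
        using \<Lambda>z by (simp add: field_simps)
      moreover have "\<phi> z = (norm (poly r z))\<^sup>2 / (norm (\<Lambda> z))\<^sup>2 - (norm u)\<^sup>2"
        by (simp add: \<phi>_def u_def diff_divide_distrib norm_divide power_divide)
      moreover have "(norm (u + \<psi> z))\<^sup>2 = (norm u)\<^sup>2 + (norm (\<psi> z))\<^sup>2 + 2 * Re (\<psi> z * cnj u)"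
        unfolding cmod_power2 by (simp add: power2_eq_square algebra_simps)
      moreover have "K z = \<psi> z * cnj u" using Kz[OF z] by (simp add: u_def)
      ultimately show ?thesis using \<epsilon>[of \<theta>] unfolding z_def[symmetric] by simp
    qed
    have int2: "(\<lambda>\<theta>. (norm (\<psi> (\<rho> * cis \<theta>)))\<^sup>2) integrable_on {0..2*pi}"
      by (intro integrable_continuous_interval continuous_intros contc)
    have "((\<lambda>\<theta>. Re (K (\<rho> * cis \<theta>))) has_integral Re 0) {0..2*pi}"
      using has_integral_linear[OF Kint bounded_linear_Re] by (simp add: o_def)
    then have "((\<lambda>\<theta>. \<epsilon> - 2 * Re (K (\<rho> * cis \<theta>))) has_integral 2*pi * \<epsilon> - 2 * Re 0) {0..2*pi}"
      using has_integral_const_real[of \<epsilon> 0 "2*pi"]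
      by (intro has_integral_diff has_integral_mult_right) auto
    then have m: "integral {0..2*pi} (\<lambda>\<theta>. (norm (\<psi> (\<rho> * cis \<theta>)))\<^sup>2) \<le> 2*pi * \<epsilon>"
      using has_integral_le[OF integrable_integral[OF int2], of "\<lambda>\<theta>. \<epsilon> - 2 * Re (K (\<rho> * cis \<theta>))"] ptw
      by simp
    have w\<rho>: "norm w < \<rho>" using s_w \<rho> w by linarith
    \<comment> \<open>For the square of \<open>\<psi>\<close> the integrand is bounded by a constant
      times the square of \<open>norm \<psi>\<close>, so the bound \<open>m\<close> applies
      directly.\<close>
    have C: "((\<lambda>\<theta>. (\<psi> (\<rho> * cis \<theta>))\<^sup>2 * (\<rho> * cis \<theta>) / (\<rho> * cis \<theta> - w)) has_integral 2*pi * (\<psi> w)\<^sup>2) {0..2*pi}"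
      by (rule Cauchy_formula_has_integral_angle[where F = "\<lambda>z. (\<psi> z)\<^sup>2"])
         (use \<rho> \<rho>0 w\<rho> in \<open>auto intro!: holomorphic_intros continuous_intros
             continuous_on_subset[OF cont\<psi>] holomorphic_on_subset[OF \<psi>]\<close>)
    have bnd: "norm ((\<psi> (\<rho> * cis \<theta>))\<^sup>2 * (\<rho> * cis \<theta>) / (\<rho> * cis \<theta> - w))
        \<le> (norm (\<psi> (\<rho> * cis \<theta>)))\<^sup>2 * (2 / (1 - norm w))" for \<theta>
    proof -
      have d: "(1 - norm w) / 2 \<le> norm (\<rho> * cis \<theta> - w)"
        using norm_triangle_ineq2[of "\<rho> * cis \<theta>" w] s_w \<rho> unfolding nz by argo
      have "norm ((\<psi> (\<rho> * cis \<theta>))\<^sup>2 * (\<rho> * cis \<theta>) / (\<rho> * cis \<theta> - w))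
        = (norm (\<psi> (\<rho> * cis \<theta>)))\<^sup>2 * (\<rho> / norm (\<rho> * cis \<theta> - w))"
        using nz[of \<theta>] by (simp add: norm_mult norm_divide norm_power)
      also have "\<dots> \<le> (norm (\<psi> (\<rho> * cis \<theta>)))\<^sup>2 * (1 / ((1 - norm w) / 2))"
        using \<rho> \<rho>0 d w by (intro mult_left_mono frac_le) auto
      finally show ?thesis by simp
    qed
    have "norm (2*pi * (\<psi> w)\<^sup>2) \<le> integral {0..2*pi} (\<lambda>\<theta>. (norm (\<psi> (\<rho> * cis \<theta>)))\<^sup>2 * (2 / (1 - norm w)))"
      unfolding integral_unique[OF C, symmetric]
      by (rule integral_norm_bound_integral[OF has_integral_integrable[OF C] integrable_on_mult_left[OF int2] bnd])
    also have "\<dots> = integral {0..2*pi} (\<lambda>\<theta>. (norm (\<psi> (\<rho> * cis \<theta>)))\<^sup>2) * (2 / (1 - norm w))"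
      by simp
    also have "\<dots> \<le> (2*pi * \<epsilon>) * (2 / (1 - norm w))"
      using m w by (intro mult_right_mono) auto
    finally have "2 * pi * (norm (\<psi> w))\<^sup>2 \<le> 2 * pi * (\<epsilon> * (2 / (1 - norm w)))"
      by (simp add: norm_mult norm_power mult_ac)
    then show ?thesis by (rule mult_left_le_imp_le) simp
  qed

  have "(norm (\<psi> w))\<^sup>2 \<le> 0 + \<epsilon>" if "\<epsilon> > 0" for \<epsilon>
  proof -
    \<comment> \<open>Scaled to cancel the factor \<open>2 / (1 - norm w)\<close> in
      \<open>circle\<close>.\<close>
    define \<epsilon>' where "\<epsilon>' = \<epsilon> * ((1 - norm w) / 2)"
    have \<epsilon>': "\<epsilon>' > 0" using that w by (simp add: \<epsilon>'_def)
    \<comment> \<open>Uniform continuity on the closed annulus makes \<open>\<phi>\<close> small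
      near the unit circle, uniformly in the angle.\<close>
    have "compact (cball 0 1 - ball (0::complex) s)" by (intro compact_diff) auto
    moreover have "continuous_on (cball 0 1 - ball 0 s) \<phi>"
      unfolding \<phi>_def \<Lambda>_def
      by (intro continuous_intros) (use \<Lambda>0 in \<open>auto simp: \<Lambda>_def\<close>)
    ultimately have "uniformly_continuous_on (cball 0 1 - ball 0 s) \<phi>"
      by (rule compact_uniformly_continuous[rotated])
    then obtain \<delta> where \<delta>: "\<delta> > 0"
      "\<And>x y. x \<in> cball 0 1 - ball 0 s \<Longrightarrow> y \<in> cball 0 1 - ball 0 s \<Longrightarrow> dist y x < \<delta> \<Longrightarrow> dist (\<phi> y) (\<phi> x) < \<epsilon>'"
      using \<epsilon>' unfolding uniformly_continuous_on_def by metis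
    define \<rho> where "\<rho> = max s (1 - \<delta>/2)"
    have \<rho>: "s \<le> \<rho>" "\<rho> < 1" "1 - \<rho> < \<delta>" using \<delta> s_less by (auto simp: \<rho>_def)
    have "\<phi> (\<rho> * cis \<theta>) \<le> \<epsilon>'" for \<theta>
    proof -
      have "\<phi> (cis \<theta>) = 0" using bdry by (simp add: \<phi>_def)
      moreover have "dist (\<rho> * cis \<theta>) (cis \<theta>) < \<delta>"
      proof -
        have "dist (\<rho> * cis \<theta>) (cis \<theta>) = norm ((complex_of_real (\<rho> - 1)) * cis \<theta>)"
          by (simp add: dist_norm algebra_simps)
        also have "\<dots> = 1 - \<rho>" using \<rho> by (simp add: norm_mult del: of_real_diff)
        finally show ?thesis using \<rho> by simp
      qed
      ultimately have "dist (\<phi> (\<rho> * cis \<theta>)) 0 < \<epsilon>'"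
        using \<delta>(2)[of "cis \<theta>" "\<rho> * cis \<theta>"] \<rho> s_pos s_less by (simp add: norm_mult)
      then show ?thesis by (simp add: dist_norm)
    qed
    then have "(norm (\<psi> w))\<^sup>2 \<le> \<epsilon>' * (2 / (1 - norm w))"
      by (intro circle[of \<rho>] \<rho>)
    then show ?thesis using w by (simp add: \<epsilon>'_def)
  qed
  then have "(norm (\<psi> w))\<^sup>2 \<le> 0" by (rule field_le_epsilon)
  then show ?thesis by simp
qed

subsection \<open>Density of the non-zeros of a polynomial\<close>

text \<open>Fixing the variables one at a time keeps some coefficient with respect to the remaining
  ones nonzero: the next variable enters through a nonzero polynomial, which has finitely many
  roots, while \<open>S j\<close> is infinite.\<close>

lemma cpoly_nonzero_on_infinite_grid:
  fixes r :: "('n::finite) cpoly" and S :: "'n \<Rightarrow> complex set"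
  assumes "r \<noteq> 0" "\<And>i. infinite (S i)"
  obtains x where "\<And>i. x $ i \<in> S i" "cpoly_eval r x \<noteq> 0"
proof -
  \<comment> \<open>substitute \<open>x\<close> for the variables in \<open>A\<close>, then take the coefficient of the remaining monomial \<open>\<beta>\<close>\<close>
  define T where "T = (\<lambda>A \<beta> (x :: 'n \<Rightarrow> complex).
    \<Sum>\<alpha> | \<alpha> \<in> Poly_Mapping.keys r \<and> (\<forall>i. i \<notin> A \<longrightarrow> Poly_Mapping.lookup \<alpha> i = \<beta> i).
      Poly_Mapping.lookup r \<alpha> * (\<Prod>i\<in>A. x i ^ Poly_Mapping.lookup \<alpha> i))"
  have "\<exists>\<beta> x. (\<forall>i. x i \<in> S i) \<and> T A \<beta> x \<noteq> 0" if "finite A" for A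
    using that
  proof (induction A rule: finite_induct)
    case empty
    obtain \<alpha> where \<alpha>: "\<alpha> \<in> Poly_Mapping.keys r"
      using \<open>r \<noteq> 0\<close> keys_eq_empty[of r] by blast
    have "\<exists>x. \<forall>i. x i \<in> S i"
    proof (intro choice allI)
      show "\<exists>u. u \<in> S i" for i using assms(2)[of i] by (cases "S i = {}") auto
    qed
    \<comment> \<open>With no variable substituted all exponents are prescribed, so \<open>T\<close>
      is a single coefficient of \<open>r\<close>.\<close>
    moreover have "{\<alpha>'. \<alpha>' \<in> Poly_Mapping.keys r \<and> (\<forall>i. i \<notin> {} \<longrightarrow> Poly_Mapping.lookup \<alpha>' i = Poly_Mapping.lookup \<alpha> i)} = {\<alpha>}"
      using \<alpha> by (auto intro: poly_mapping_eqI)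
    then have "T {} (Poly_Mapping.lookup \<alpha>) x \<noteq> 0" for x
      using \<alpha> unfolding T_def by (simp add: in_keys_iff)
    ultimately show ?case by blast
  next
    case (insert j A)
    then obtain \<beta> x where x: "\<forall>i. x i \<in> S i" "T A \<beta> x \<noteq> 0" by blast
    define K where "K = {\<alpha> \<in> Poly_Mapping.keys r. \<forall>i. i \<notin> insert j A \<longrightarrow> Poly_Mapping.lookup \<alpha> i = \<beta> i}"
    \<comment> \<open>This is \<open>T (insert j A) \<beta>\<close> as a polynomial in the variable
      \<open>j\<close>, the others being kept at \<open>x\<close>. Its coefficient of degree
      \<open>\<beta> j\<close> is \<open>T A \<beta> x\<close>, hence nonzero.\<close>
    define p where "p = (\<Sum>\<alpha>\<in>K. monom (Poly_Mapping.lookup r \<alpha> * (\<Prod>i\<in>A. x i ^ Poly_Mapping.lookup \<alpha> i)) (Poly_Mapping.lookup \<alpha> j))"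
    have finK: "finite K" by (simp add: K_def)
    have "coeff p (\<beta> j) = (\<Sum>\<alpha>\<in>K. if Poly_Mapping.lookup \<alpha> j = \<beta> j then
        Poly_Mapping.lookup r \<alpha> * (\<Prod>i\<in>A. x i ^ Poly_Mapping.lookup \<alpha> i) else 0)"
      by (simp add: p_def coeff_sum)
    also have "\<dots> = (\<Sum>\<alpha>\<in>K \<inter> {\<alpha>. Poly_Mapping.lookup \<alpha> j = \<beta> j}. Poly_Mapping.lookup r \<alpha> * (\<Prod>i\<in>A. x i ^ Poly_Mapping.lookup \<alpha> i))"
      using finK by (simp add: sum.If_cases)
    also have "K \<inter> {\<alpha>. Poly_Mapping.lookup \<alpha> j = \<beta> j} =
        {\<alpha> \<in> Poly_Mapping.keys r. \<forall>i. i \<notin> A \<longrightarrow> Poly_Mapping.lookup \<alpha> i = \<beta> i}"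
      using insert.hyps by (auto simp: K_def)
    finally have "coeff p (\<beta> j) = T A \<beta> x" by (simp add: T_def)
    then have "p \<noteq> 0" using x by auto
    then have "\<not> S j \<subseteq> {u. poly p u = 0}"
      using assms(2)[of j] poly_roots_finite finite_subset by metis
    then obtain u where u: "u \<in> S j" "poly p u \<noteq> 0" by blast
    have "poly p u = T (insert j A) \<beta> (x(j := u))"
    proof -
      have "(\<Prod>i\<in>A. (x(j := u)) i ^ Poly_Mapping.lookup \<alpha> i) = (\<Prod>i\<in>A. x i ^ Poly_Mapping.lookup \<alpha> i)" for \<alpha>
        by (rule prod.cong) (use insert.hyps in auto)
      then show ?thesis
        using insert.hyps by (simp add: p_def T_def K_def poly_sum poly_monom mult_ac)
    qed
    then have "T (insert j A) \<beta> (x(j := u)) \<noteq> 0" using u by simp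
    moreover have "\<forall>i. (x(j := u)) i \<in> S i" using u x(1) by simp
    ultimately show ?case by blast
  qed
  from this[of UNIV] obtain \<beta> x where "\<forall>i. x i \<in> S i" "T UNIV \<beta> x \<noteq> 0" by auto
  then show ?thesis
    by (intro that[of "\<chi> i. x i"]) (auto simp: T_def cpoly_eval_def)
qed

section \<open>Approximating sequences on the torus and in the polydisc\<close>

lemma tendsto_ex_sequence:
  fixes w :: "complex ^ 'n::finite"
  assumes "\<And>k::nat. \<exists>x. P x \<and> (\<forall>i. dist (x $ i) (w $ i) < 1 / real (Suc k))"
  obtains X where "\<And>k::nat. P (X k)" "X \<longlonglongrightarrow> w"
proof -
  have "\<exists>X. \<forall>k. P (X k) \<and> (\<forall>i. dist (X k $ i) (w $ i) < 1 / real (Suc k))"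
    by (intro choice allI assms)
  then obtain X where X: "\<And>k. P (X k)" "\<And>k i. dist (X k $ i) (w $ i) < 1 / real (Suc k)"
    by blast
  have "(\<lambda>k. X k $ i) \<longlonglongrightarrow> w $ i" for i
  proof (rule tendsto_dist_iff[THEN iffD2], rule tendsto_sandwich[of "\<lambda>_. 0"])
    show "(\<lambda>k. 1 / real (Suc k)) \<longlonglongrightarrow> 0"
      using LIMSEQ_inverse_real_of_nat by (simp add: inverse_eq_divide)
    show "\<forall>\<^sub>F k in sequentially. dist (X k $ i) (w $ i) \<le> 1 / real (Suc k)"
      by (intro always_eventually allI less_imp_le X(2))
  qed auto
  then have "X \<longlonglongrightarrow> w" by (rule vec_tendstoI)
  with X(1) that show ?thesis by blast
qed

text \<open>Every ball around a limit point of \<open>S i\<close> meets \<open>S i\<close> in an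
  infinite set, so the grid can be taken arbitrarily close to \<open>w\<close>. The sets will be
  unit circles or open unit discs.\<close>

lemma cpoly_nonzero_sequence:
  fixes r :: "('n::finite) cpoly" and S :: "'n \<Rightarrow> complex set"
  assumes "r \<noteq> 0" "\<And>i. w $ i islimpt S i"
  obtains X where "\<And>k i. X k $ i \<in> S i" "\<And>k. cpoly_eval r (X k) \<noteq> 0" "X \<longlonglongrightarrow> w"
proof (rule tendsto_ex_sequence[of "\<lambda>x. (\<forall>i. x $ i \<in> S i) \<and> cpoly_eval r x \<noteq> 0" w])
  fix k
  have "infinite (S i \<inter> ball (w $ i) (1 / real (Suc k)))" for i
    using assms(2)[of i] unfolding islimpt_eq_infinite_ball by simp
  then obtain x where "\<And>i. x $ i \<in> S i \<inter> ball (w $ i) (1 / real (Suc k))" "cpoly_eval r x \<noteq> 0"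
    using cpoly_nonzero_on_infinite_grid[OF assms(1), of "\<lambda>i. S i \<inter> ball (w $ i) (1 / real (Suc k))"] by blast
  then show "\<exists>x. ((\<forall>i. x $ i \<in> S i) \<and> cpoly_eval r x \<noteq> 0) \<and> (\<forall>i. dist (x $ i) (w $ i) < 1 / real (Suc k))"
    by (intro exI[of _ x]) (auto simp: dist_commute)
next
  fix X :: "nat \<Rightarrow> complex ^ 'n"
  assume "\<And>k. (\<forall>i. X k $ i \<in> S i) \<and> cpoly_eval r (X k) \<noteq> 0" "X \<longlonglongrightarrow> w"
  then show thesis by (intro that[of X]) blast+
qed

lemma tendsto_cpoly_eval [tendsto_intros]:
  fixes p :: "('n::finite) cpoly"
  assumes "(h \<longlongrightarrow> w) F"
  shows "((\<lambda>x. cpoly_eval p (h x)) \<longlongrightarrow> cpoly_eval p w) F"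
  unfolding cpoly_eval_def by (intro tendsto_intros assms)

lemma islimpt_sphere:
  fixes u :: complex
  assumes "norm u = 1"
  shows "u islimpt sphere 0 1"
proof (rule connected_imp_perfect)
  show "connected (sphere (0::complex) 1)" by (rule connected_sphere) simp
  have "1 \<in> sphere (0::complex) 1" "- 1 \<in> sphere (0::complex) 1" by auto
  then show "sphere (0::complex) 1 \<noteq> {x}" for x
    by (metis one_neq_neg_one singletonD)
qed (use assms in auto)

text \<open>A box of angles has positive measure and so cannot lie in a null set, and small changes
  of the angles move the torus point little.\<close>

lemma AE_torus_measure_sequence:
  fixes w :: "complex ^ 'n::finite"
  assumes ae: "AE x in torus_measure. P x" and w: "\<And>i. norm (w $ i) = 1"
  obtains X where "\<And>k i. norm (X k $ i) = 1" "\<And>k. P (X k)" "X \<longlonglongrightarrow> w"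
proof (rule tendsto_ex_sequence[of "\<lambda>x. (\<forall>i. norm (x $ i) = 1) \<and> P x" w])
  fix k :: nat
  define \<Omega> where "\<Omega> = {\<theta> :: real ^ 'n. \<forall>i. 0 \<le> \<theta> $ i \<and> \<theta> $ i < 2 * pi}"
  define e where "e = (\<lambda>\<theta> :: real ^ 'n. (\<chi> i. cis (\<theta> $ i)) :: complex ^ 'n)"
  have "continuous_on UNIV e"
    unfolding e_def by (intro continuous_intros)
  then have "e \<in> borel_measurable (restrict_space lborel \<Omega>)"
    by (intro measurable_restrict_space1) (simp add: borel_measurable_continuous_onI)
  then have "AE \<theta> in restrict_space lborel \<Omega>. P (e \<theta>)"
    using ae unfolding torus_measure_def e_def \<Omega>_def by (rule AE_distrD)
  moreover have "\<Omega> \<in> sets borel"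
    unfolding \<Omega>_def by measurable
  ultimately have AE: "AE \<theta> in lborel. \<theta> \<in> \<Omega> \<longrightarrow> P (e \<theta>)"
    by (subst (asm) AE_restrict_space_iff) auto
  define a where "a = (\<chi> i. Arg2pi (w $ i))"
  have wa: "w $ i = cis (a $ i)" for i
    using w[of i] Arg2pi[of "w $ i"] by (simp add: a_def cis_conv_exp is_Arg_def mult_ac)
  have a: "0 \<le> a $ i" "a $ i < 2 * pi" for i
    using Arg2pi[of "w $ i"] by (auto simp: a_def)
  \<comment> \<open>The box lies just above the arguments and is capped at \<open>2 * pi\<close>, so
    it stays inside \<open>\<Omega>\<close> even when an argument is 0.\<close>
  define b where "b = (\<chi> i. min (2 * pi) (a $ i + 1 / real (Suc k)))"
  have ab: "a $ i < b $ i" for i using a by (simp add: b_def)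
  have "emeasure lborel (box a b) = (\<Prod>u\<in>Basis. (b - a) \<bullet> u)"
    by (rule emeasure_lborel_box) (use less_imp_le[OF ab] in \<open>auto simp: Basis_vec_def inner_axis\<close>)
  also have "\<dots> \<noteq> 0"
  proof -
    have "0 < (\<Prod>u\<in>Basis. (b - a) \<bullet> u)"
      by (rule prod_pos) (use ab in \<open>auto simp: Basis_vec_def inner_axis\<close>)
    then show ?thesis by (metis ennreal_eq_0_iff not_le)
  qed
  finally have "emeasure lborel (box a b) \<noteq> 0" .
  then have "\<not> (AE \<theta> in lborel. \<theta> \<notin> box a b)"
    using AE_iff_null_sets[of "box a b" lborel] by (auto simp: null_sets_def)
  have "\<exists>\<theta>. \<theta> \<in> box a b \<and> (\<theta> \<in> \<Omega> \<longrightarrow> P (e \<theta>))"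
  proof (rule ccontr)
    assume "\<not> ?thesis"
    then have "AE \<theta> in lborel. \<theta> \<notin> box a b"
      by (intro eventually_mono[OF AE]) blast
    with \<open>\<not> (AE \<theta> in lborel. \<theta> \<notin> box a b)\<close> show False by blast
  qed
  then obtain \<theta> where \<theta>: "\<theta> \<in> box a b" "\<theta> \<in> \<Omega> \<longrightarrow> P (e \<theta>)" by blast
  have \<theta>i: "a $ i < \<theta> $ i" "\<theta> $ i < b $ i" for i
    using \<theta>(1) by (auto simp: mem_box_cart)
  have "0 \<le> \<theta> $ i \<and> \<theta> $ i < 2 * pi" for i
    using \<theta>i[of i] a[of i] by (simp add: b_def)
  then have "\<theta> \<in> \<Omega>" by (simp add: \<Omega>_def)
  moreover have "dist (e \<theta> $ i) (w $ i) < 1 / real (Suc k)" for i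
  proof -
    have "dist (e \<theta> $ i) (w $ i) = norm (cis (\<theta> $ i) - cis (a $ i))"
      by (simp add: e_def wa dist_norm)
    also have "cis (\<theta> $ i) - cis (a $ i) = cis (a $ i) * (cis (\<theta> $ i - a $ i) - 1)"
      by (simp add: algebra_simps cis_mult)
    also have "norm \<dots> = norm (exp (\<i> * of_real (\<theta> $ i - a $ i)) - 1)"
      by (simp add: norm_mult cis_conv_exp)
    \<comment> \<open>A chord is no longer than its arc: for an angle \<open>t\<close> its length is
      \<open>2 * \<bar>sin (t / 2)\<bar>\<close>.\<close>
    also have "\<dots> \<le> \<bar>\<theta> $ i - a $ i\<bar>"
      using abs_sin_x_le_abs_x[of "(\<theta> $ i - a $ i) / 2"] unfolding dist_exp_i_1 by simp
    finally show ?thesis using \<theta>i[of i] by (simp add: b_def)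
  qed
  ultimately show "\<exists>x. ((\<forall>i. norm (x $ i) = 1) \<and> P x) \<and> (\<forall>i. dist (x $ i) (w $ i) < 1 / real (Suc k))"
    using \<theta>(2) by (intro exI[of _ "e \<theta>"]) (auto simp: e_def)
next
  fix X :: "nat \<Rightarrow> complex ^ 'n"
  assume "\<And>k. (\<forall>i. norm (X k $ i) = 1) \<and> P (X k)" "X \<longlonglongrightarrow> w"
  then show thesis by (intro that[of X]) blast+
qed

subsection \<open>Slices of rational inner functions\<close>

text \<open>The coefficient of degree \<open>d\<close> is the homogeneous part of \<open>p\<close>
  of degree \<open>d\<close>, evaluated at \<open>w\<close>.\<close>

definition slice_poly :: "('n::finite) cpoly \<Rightarrow> complex ^ 'n \<Rightarrow> complex poly" where
  "slice_poly p w = (\<Sum>m\<in>Poly_Mapping.keys p.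
     monom (Poly_Mapping.lookup p m * (\<Prod>i\<in>UNIV. w $ i ^ Poly_Mapping.lookup m i)) (\<Sum>i\<in>UNIV. Poly_Mapping.lookup m i))"

lemma poly_slice_poly: "poly (slice_poly p w) z = cpoly_eval p (z *s w)"
  by (simp add: slice_poly_def cpoly_eval_def poly_sum poly_monom power_mult_distrib prod.distrib power_sum mult_ac)

lemma degree_slice_poly_le: "degree (slice_poly p w) \<le> total_degree p"
proof -
  have "(\<Sum>i\<in>UNIV. Poly_Mapping.lookup m i) \<le> total_degree p" if "m \<in> Poly_Mapping.keys p" for m
    unfolding total_degree_def by (rule Max_ge) (use that in auto)
  then show ?thesis
    unfolding slice_poly_def
    by (intro degree_sum_le) (auto intro: order_trans[OF degree_monom_le])
qed

section \<open>Compactness for pairs of polynomials\<close>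

lemma bounded_family_subsequence:
  fixes c :: "nat \<Rightarrow> 'j \<Rightarrow> complex"
  assumes "finite J" "\<And>k j. j \<in> J \<Longrightarrow> norm (c k j) \<le> B"
  shows "\<exists>\<sigma> l. strict_mono (\<sigma> :: nat \<Rightarrow> nat) \<and> (\<forall>j\<in>J. (\<lambda>k. c (\<sigma> k) j) \<longlonglongrightarrow> l j)"
  using assms
proof (induction J rule: finite_induct)
  case empty
  show ?case by (intro exI[of _ id]) (auto simp: strict_mono_def)
next
  case (insert j J)
  then obtain \<sigma> l where \<sigma>: "strict_mono \<sigma>" "\<And>i. i \<in> J \<Longrightarrow> (\<lambda>k. c (\<sigma> k) i) \<longlonglongrightarrow> l i"
    by (metis insertCI)
  have "bounded (range (\<lambda>k. c (\<sigma> k) j))"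
    using insert.prems by (auto intro!: boundedI[of _ B])
  then obtain l' \<sigma>' where \<sigma>': "strict_mono (\<sigma>' :: nat \<Rightarrow> nat)" "((\<lambda>k. c (\<sigma> k) j) \<circ> \<sigma>') \<longlonglongrightarrow> l'"
    using bounded_imp_convergent_subsequence by blast
  have "(\<lambda>k. c ((\<sigma> \<circ> \<sigma>') k) i) \<longlonglongrightarrow> (l(j := l')) i" if "i \<in> insert j J" for i
  proof (cases "i = j")
    case True
    then show ?thesis using \<sigma>'(2) by (simp add: o_def)
  next
    case False
    then show ?thesis
      using LIMSEQ_subseq_LIMSEQ[OF \<sigma>(2) \<sigma>'(1)] that by (simp add: o_def)
  qed
  then show ?case
    using strict_mono_o[OF \<sigma>(1) \<sigma>'(1)] by blast
qed

lemma poly_eq_sum_coeff: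
  fixes p :: "'a::comm_ring_1 poly"
  assumes "degree p \<le> d"
  shows "poly p z = (\<Sum>j\<le>d. coeff p j * z ^ j)"
  unfolding poly_altdef using assms
  by (intro sum.mono_neutral_left) (auto simp: coeff_eq_0)

lemma infinite_unit_circle: "infinite {z :: complex. norm z = 1}"
  using islimpt_sphere[of 1] islimpt_finite[of "sphere (0::complex) 1"] by (auto simp: sphere_def dist_norm)

text \<open>A slice along which the denominator vanishes identically is reached as a limit of nearby
  slices, normalised so that the coefficients stay bounded and do not all tend to 0.\<close>

lemma normalised_poly_pair_subsequence:
  fixes Q R :: "nat \<Rightarrow> complex poly"
  assumes dQ: "\<And>k. degree (Q k) \<le> m" and dR: "\<And>k. degree (R k) \<le> n"
    and R0: "\<And>k. R k \<noteq> 0"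
    and bdry: "\<And>k z. norm z = 1 \<Longrightarrow> norm (poly (Q k) z) = norm (poly (R k) z)"
  obtains q r \<sigma> s where "degree q \<le> m" "r \<noteq> 0"
    "\<forall>z. norm z = 1 \<longrightarrow> norm (poly q z) = norm (poly r z)"
    "strict_mono (\<sigma> :: nat \<Rightarrow> nat)"
    "\<forall>z. (\<lambda>k. s k * poly (Q (\<sigma> k)) z) \<longlonglongrightarrow> poly q z"
    "\<forall>z. (\<lambda>k. s k * poly (R (\<sigma> k)) z) \<longlonglongrightarrow> poly r z"
proof -
  \<comment> \<open>Division by \<open>S k\<close> puts all coefficients in the closed unit disc;
    \<open>S k\<close> is positive because \<open>R k\<close> is nonzero.\<close>
  define S where "S = (\<lambda>k. (\<Sum>j\<le>m. norm (coeff (Q k) j)) + (\<Sum>j\<le>n. norm (coeff (R k) j)))"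
  have S_pos: "S k > 0" for k
  proof -
    have "norm (coeff (R k) (degree (R k))) \<le> (\<Sum>j\<le>n. norm (coeff (R k) j))"
      by (rule member_le_sum) (use dR in auto)
    moreover have "norm (coeff (R k) (degree (R k))) > 0" using R0 by simp
    moreover have "(\<Sum>j\<le>m. norm (coeff (Q k) j)) \<ge> 0" by (intro sum_nonneg) auto
    ultimately show ?thesis unfolding S_def by linarith
  qed
  have Qle: "norm (coeff (Q k) j) \<le> S k" if "j \<le> m" for k j
  proof -
    have "norm (coeff (Q k) j) \<le> (\<Sum>j\<le>m. norm (coeff (Q k) j))"
      by (rule member_le_sum) (use that in auto)
    then show ?thesis by (simp add: S_def sum_nonneg add_increasing2)
  qed
  have Rle: "norm (coeff (R k) j) \<le> S k" if "j \<le> n" for k j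
  proof -
    have "norm (coeff (R k) j) \<le> (\<Sum>j\<le>n. norm (coeff (R k) j))"
      by (rule member_le_sum) (use that in auto)
    then show ?thesis by (simp add: S_def sum_nonneg add_increasing)
  qed
  define t where "t = (\<lambda>k. complex_of_real (1 / S k))"
  have nt: "norm (t k) = 1 / S k" for k using S_pos[of k] by (simp add: t_def norm_divide)
  have Q1: "norm (t k * coeff (Q k) j) \<le> 1" if "j \<in> {..m}" for k j
    using Qle[of j k] that S_pos[of k] by (simp add: norm_mult nt)
  obtain \<sigma>1 a where
    \<sigma>1: "strict_mono (\<sigma>1 :: nat \<Rightarrow> nat)" "\<And>j. j \<le> m \<Longrightarrow> (\<lambda>k. t (\<sigma>1 k) * coeff (Q (\<sigma>1 k)) j) \<longlonglongrightarrow> a j"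
    using bounded_family_subsequence[of "{..m}" "\<lambda>k j. t k * coeff (Q k) j", OF finite_atMost Q1] by auto
  have R1: "norm (t (\<sigma>1 k) * coeff (R (\<sigma>1 k)) j) \<le> 1" if "j \<in> {..n}" for k j
    using Rle[of j "\<sigma>1 k"] that S_pos[of "\<sigma>1 k"] by (simp add: norm_mult nt)
  \<comment> \<open>The second extraction runs inside the first subsequence, so that both families
    converge along the composition.\<close>
  obtain \<sigma>2 b where
    \<sigma>2: "strict_mono (\<sigma>2 :: nat \<Rightarrow> nat)"
      "\<And>j. j \<le> n \<Longrightarrow> (\<lambda>k. t (\<sigma>1 (\<sigma>2 k)) * coeff (R (\<sigma>1 (\<sigma>2 k))) j) \<longlonglongrightarrow> b j"
    using bounded_family_subsequence[of "{..n}" "\<lambda>k j. t (\<sigma>1 k) * coeff (R (\<sigma>1 k)) j", OF finite_atMost R1] by auto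
  define \<sigma> where "\<sigma> = \<sigma>1 \<circ> \<sigma>2"
  have \<sigma>: "strict_mono \<sigma>" unfolding \<sigma>_def by (rule strict_mono_o[OF \<sigma>1(1) \<sigma>2(1)])
  have a: "(\<lambda>k. t (\<sigma> k) * coeff (Q (\<sigma> k)) j) \<longlonglongrightarrow> a j" if "j \<le> m" for j
    using LIMSEQ_subseq_LIMSEQ[OF \<sigma>1(2)[OF that] \<sigma>2(1)] by (simp add: \<sigma>_def o_def)
  have b: "(\<lambda>k. t (\<sigma> k) * coeff (R (\<sigma> k)) j) \<longlonglongrightarrow> b j" if "j \<le> n" for j
    using \<sigma>2(2)[OF that] by (simp add: \<sigma>_def)
  define q where "q = (\<Sum>j\<le>m. monom (a j) j)"
  define r where "r = (\<Sum>j\<le>n. monom (b j) j)"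
  have coeff_q: "coeff q j = a j" if "j \<le> m" for j
    using that by (simp add: q_def coeff_sum)
  have coeff_r: "coeff r j = b j" if "j \<le> n" for j
    using that by (simp add: r_def coeff_sum)
  have lim_q: "(\<lambda>k. t (\<sigma> k) * poly (Q (\<sigma> k)) z) \<longlonglongrightarrow> poly q z" for z
  proof -
    have "(\<lambda>k. \<Sum>j\<le>m. t (\<sigma> k) * coeff (Q (\<sigma> k)) j * z ^ j) \<longlonglongrightarrow> (\<Sum>j\<le>m. a j * z ^ j)"
      by (intro tendsto_intros a) auto
    then show ?thesis
      by (simp add: poly_eq_sum_coeff[OF dQ] sum_distrib_left mult_ac q_def poly_sum poly_monom)
  qed
  have lim_r: "(\<lambda>k. t (\<sigma> k) * poly (R (\<sigma> k)) z) \<longlonglongrightarrow> poly r z" for z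
  proof -
    have "(\<lambda>k. \<Sum>j\<le>n. t (\<sigma> k) * coeff (R (\<sigma> k)) j * z ^ j) \<longlonglongrightarrow> (\<Sum>j\<le>n. b j * z ^ j)"
      by (intro tendsto_intros b) auto
    then show ?thesis
      by (simp add: poly_eq_sum_coeff[OF dR] sum_distrib_left mult_ac r_def poly_sum poly_monom)
  qed
  have bd: "norm (poly q z) = norm (poly r z)" if "norm z = 1" for z
  proof -
    have "(\<lambda>k. norm (t (\<sigma> k) * poly (Q (\<sigma> k)) z)) \<longlonglongrightarrow> norm (poly q z)"
      by (intro tendsto_norm lim_q)
    moreover have "(\<lambda>k. norm (t (\<sigma> k) * poly (R (\<sigma> k)) z)) \<longlonglongrightarrow> norm (poly r z)"
      by (intro tendsto_norm lim_r)
    ultimately show ?thesis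
      unfolding norm_mult bdry[OF that] by (rule LIMSEQ_unique)
  qed
  have "norm (t k) * S k = 1" for k using S_pos[of k] by (simp add: nt)
  \<comment> \<open>The normalisation passes to the limit, so the two limit polynomials cannot both
    be zero.\<close>
  then have unit: "(\<Sum>j\<le>m. norm (t k * coeff (Q k) j)) + (\<Sum>j\<le>n. norm (t k * coeff (R k) j)) = 1" for k
    by (simp add: S_def norm_mult sum_distrib_left distrib_left)
  have "(\<lambda>k. (\<Sum>j\<le>m. norm (t (\<sigma> k) * coeff (Q (\<sigma> k)) j)) + (\<Sum>j\<le>n. norm (t (\<sigma> k) * coeff (R (\<sigma> k)) j)))
      \<longlonglongrightarrow> (\<Sum>j\<le>m. norm (a j)) + (\<Sum>j\<le>n. norm (b j))"
    by (intro tendsto_add tendsto_sum tendsto_norm a b) auto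
  from LIMSEQ_unique[OF this[unfolded unit] tendsto_const]
  have sum1: "(\<Sum>j\<le>m. norm (a j)) + (\<Sum>j\<le>n. norm (b j)) = 1" .
  \<comment> \<open>If \<open>r\<close> were zero, equality of moduli would make \<open>q\<close>
    vanish on the unit circle, so \<open>q\<close> would be zero too.\<close>
  have "r \<noteq> 0"
  proof
    assume r: "r = 0"
    then have "{z. norm z = 1} \<subseteq> {z. poly q z = 0}" using bd by auto
    then have "q = 0"
      using infinite_unit_circle poly_roots_finite finite_subset by blast
    with r have "\<And>j. j \<le> m \<Longrightarrow> a j = 0" "\<And>j. j \<le> n \<Longrightarrow> b j = 0"
      using coeff_q coeff_r by (metis coeff_0)+
    with sum1 show False by simp
  qed
  moreover have "degree q \<le> m"
    unfolding q_def by (intro degree_sum_le) (auto intro: order_trans[OF degree_monom_le])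
  ultimately show ?thesis
    using bd \<sigma> lim_q lim_r by (intro that[of q r \<sigma> "\<lambda>k. t (\<sigma> k)"]) auto
qed

section \<open>Restriction to complex lines and to single coordinates\<close>

lemma analytic_several_onD_has_derivative:
  assumes "analytic_several_on h U" "z \<in> U"
  obtains h' where "(h has_derivative h') (at z)" "\<And>c v. h' (c *s v) = c * h' v"
  using assms unfolding analytic_several_on_def by blast

lemma analytic_several_on_continuous_on:
  assumes "analytic_several_on h U"
  shows "continuous_on U h"
  using assms unfolding analytic_several_on_def
  by (meson continuous_at_imp_continuous_on has_derivative_continuous)

lemma analytic_several_on_diff:
  assumes "analytic_several_on g U" "analytic_several_on f U"
  shows "analytic_several_on (\<lambda>x. g x - f x) U"
  unfolding analytic_several_on_def
proof
  fix z assume "z \<in> U"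
  then obtain g' f' where "(g has_derivative g') (at z)" "(f has_derivative f') (at z)"
    "\<And>c v. g' (c *s v) = c * g' v" "\<And>c v. f' (c *s v) = c * f' v"
    using assms analytic_several_onD_has_derivative by meson
  then show "\<exists>h'. ((\<lambda>x. g x - f x) has_derivative h') (at z) \<and> (\<forall>c v. h' (c *s v) = c * h' v)"
    by (intro exI[of _ "\<lambda>v. g' v - f' v"]) (auto intro: has_derivative_diff simp: algebra_simps)
qed

text \<open>By the chain rule and complex linearity of the derivative \<open>h'\<close>, the
  restriction to the line has complex derivative \<open>h' v\<close>.\<close>

lemma analytic_several_on_line_holomorphic:
  fixes b v :: "complex ^ 'n"
  assumes h: "analytic_several_on h U" and A: "\<And>u. u \<in> A \<Longrightarrow> b + u *s v \<in> U"
  shows "(\<lambda>u. h (b + u *s v)) holomorphic_on A"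
  unfolding holomorphic_on_def
proof
  fix u assume "u \<in> A"
  then obtain h' where h': "(h has_derivative h') (at (b + u *s v))" "\<And>c v. h' (c *s v) = c * h' v"
    using h A analytic_several_onD_has_derivative by metis
  have "linear (\<lambda>u. u *s v)"
    by (rule linearI) (auto simp: vector_sadd_rdistrib vec_eq_iff algebra_simps)
  then have "bounded_linear (\<lambda>u. u *s v)"
    by (simp add: linear_conv_bounded_linear)
  then have "((\<lambda>u. b + u *s v) has_derivative (\<lambda>u. u *s v)) (at u within A)"
    using has_derivative_add[OF has_derivative_const bounded_linear.has_derivative[OF _ has_derivative_ident]]
    by fastforce
  from has_derivative_compose[OF this h'(1)] show "(\<lambda>u. h (b + u *s v)) field_differentiable at u within A"
    unfolding field_differentiable_def has_field_derivative_def
    by (intro exI[of _ "h' v"]) (simp add: h'(2) mult.commute[of _ "h' v"])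
qed

lemma slice_mem_polydisc:
  assumes "\<And>i. norm (w $ i) = 1" "norm z < 1"
  shows "z *s w \<in> polydisc"
  using assms by (simp add: polydisc_def norm_mult)

lemma analytic_several_on_slice_holomorphic:
  assumes "analytic_several_on h polydisc" "\<And>i. norm (w $ i) = 1"
  shows "(\<lambda>z. h (z *s w)) holomorphic_on ball 0 1"
  using analytic_several_on_line_holomorphic[OF assms(1), of "ball 0 1" 0 w] slice_mem_polydisc[OF assms(2)]
  by simp

definition replace_coord :: "'n \<Rightarrow> complex ^ 'n \<Rightarrow> complex \<Rightarrow> complex ^ 'n" where
  "replace_coord j x u = (\<chi> i. if i = j then u else x $ i)"

lemma analytic_several_on_coord_holomorphic:
  assumes "analytic_several_on h polydisc" "\<And>i. i \<noteq> j \<Longrightarrow> norm (x $ i) < 1"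
  shows "(\<lambda>u. h (replace_coord j x u)) holomorphic_on ball 0 1"
proof -
  \<comment> \<open>The base point has coordinate \<open>j\<close> set to 0, so that the parameter
    of the line is coordinate \<open>j\<close> itself.\<close>
  have eq: "replace_coord j x 0 + u *s axis j 1 = replace_coord j x u" for u
    by (auto simp: vec_eq_iff replace_coord_def axis_def)
  have "(\<lambda>u. h (replace_coord j x 0 + u *s axis j 1)) holomorphic_on ball 0 1"
  proof (rule analytic_several_on_line_holomorphic[OF assms(1)])
    fix u :: complex assume "u \<in> ball 0 1"
    then show "replace_coord j x 0 + u *s axis j 1 \<in> polydisc"
      unfolding eq using assms(2) by (auto simp: polydisc_def replace_coord_def)
  qed
  then show ?thesis unfolding eq .
qed

text \<open>Multiplying out the denominator gives identities between continuous functions, which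
  extend by density from the points where the fraction determines \<open>f\<close>.\<close>

lemma rational_inner_fraction:
  fixes f :: "complex ^ 'n::finite \<Rightarrow> complex"
  assumes "f \<in> rational_inner N"
  obtains q r where "r \<noteq> 0" "total_degree q < N"
    "\<forall>x. (\<forall>i. norm (x $ i) = 1) \<longrightarrow> norm (cpoly_eval q x) = norm (cpoly_eval r x)"
    "\<forall>x\<in>polydisc. f x * cpoly_eval r x = cpoly_eval q x"
proof -
  obtain q r where r: "r \<noteq> 0" and dq: "total_degree q < N" and
    fqr: "\<And>z. cpoly_eval r z \<noteq> 0 \<Longrightarrow> f z = cpoly_eval q z / cpoly_eval r z"
    using assms unfolding rational_inner_def reduced_fraction_def by blast
  have an: "analytic_several_on f polydisc" and ae: "AE x in torus_measure. norm (f x) = 1"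
    using assms unfolding rational_inner_def inner_function_def by auto
  have closed_limit: "norm (cpoly_eval q x) = norm (cpoly_eval r x)"
    if "X \<longlonglongrightarrow> x" "\<forall>\<^sub>F k in sequentially. norm (cpoly_eval q (X k)) = norm (cpoly_eval r (X k))" for X x
  proof (rule LIMSEQ_unique)
    show "(\<lambda>k. norm (cpoly_eval r (X k))) \<longlonglongrightarrow> norm (cpoly_eval r x)"
      by (intro tendsto_intros that)
    have "(\<lambda>k. norm (cpoly_eval q (X k))) \<longlonglongrightarrow> norm (cpoly_eval q x)"
      by (intro tendsto_intros that)
    then show "(\<lambda>k. norm (cpoly_eval r (X k))) \<longlonglongrightarrow> norm (cpoly_eval q x)"
      by (rule Lim_transform_eventually) (use that(2) in auto)
  qed
  \<comment> \<open>First limit: near a torus point with \<open>r\<close> nonzero the fraction gives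
    \<open>f\<close>, whose modulus is 1 at torus points arbitrarily close by.\<close>
  have generic: "norm (cpoly_eval q x) = norm (cpoly_eval r x)"
    if x: "\<And>i. norm (x $ i) = 1" and rx: "cpoly_eval r x \<noteq> 0" for x
  proof -
    obtain X where X: "\<And>k. norm (f (X k)) = 1" "X \<longlonglongrightarrow> x"
      using AE_torus_measure_sequence[OF ae x] by metis
    have "(\<lambda>k. cpoly_eval r (X k)) \<longlonglongrightarrow> cpoly_eval r x" by (intro tendsto_intros X)
    then have "\<forall>\<^sub>F k in sequentially. cpoly_eval r (X k) \<noteq> 0" using rx by (rule tendsto_imp_eventually_ne)
    then have "\<forall>\<^sub>F k in sequentially. norm (cpoly_eval q (X k)) = norm (cpoly_eval r (X k))"
    proof (rule eventually_mono)
      fix k assume "cpoly_eval r (X k) \<noteq> 0"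
      then show "norm (cpoly_eval q (X k)) = norm (cpoly_eval r (X k))"
        using X(1)[of k] fqr[of "X k"] by (simp add: norm_divide)
    qed
    with X(2) show ?thesis by (rule closed_limit)
  qed
  \<comment> \<open>Second limit: the torus points with \<open>r\<close> nonzero are dense in the
    torus.\<close>
  have torus: "norm (cpoly_eval q x) = norm (cpoly_eval r x)" if x: "\<And>i. norm (x $ i) = 1" for x
  proof -
    have "x $ i islimpt sphere 0 1" for i using x by (rule islimpt_sphere)
    then obtain X where X: "\<And>k i. X k $ i \<in> sphere 0 1" "\<And>k. cpoly_eval r (X k) \<noteq> 0" "X \<longlonglongrightarrow> x"
      using cpoly_nonzero_sequence[OF r, of x "\<lambda>_. sphere 0 1"] by metis
    show ?thesis
      by (rule closed_limit[OF X(3)]) (use X in \<open>auto intro!: always_eventually generic\<close>)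
  qed
  \<comment> \<open>Inside the polydisc, continuity of \<open>f\<close> carries the identity over to
    the zeros of \<open>r\<close>.\<close>
  have "f x * cpoly_eval r x = cpoly_eval q x" if x: "x \<in> polydisc" for x
  proof -
    have "x $ i islimpt ball 0 1" for i using x by (auto simp: islimpt_ball polydisc_def less_imp_le)
    then obtain X where X: "\<And>k i. X k $ i \<in> ball 0 1" "\<And>k. cpoly_eval r (X k) \<noteq> 0" "X \<longlonglongrightarrow> x"
      using cpoly_nonzero_sequence[OF r, of x "\<lambda>_. ball 0 1"] by metis
    have Xp: "X k \<in> polydisc" for k using X(1) by (simp add: polydisc_def)
    have "(\<lambda>k. f (X k)) \<longlonglongrightarrow> f x"
      using analytic_several_on_continuous_on[OF an] Xp x X(3)
      by (auto simp: continuous_on_sequentially o_def)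
    then have "(\<lambda>k. f (X k) * cpoly_eval r (X k)) \<longlonglongrightarrow> f x * cpoly_eval r x"
      by (intro tendsto_intros X)
    moreover have "f (X k) * cpoly_eval r (X k) = cpoly_eval q (X k)" for k
      using fqr X(2) by simp
    moreover have "(\<lambda>k. cpoly_eval q (X k)) \<longlonglongrightarrow> cpoly_eval q x" by (intro tendsto_intros X)
    ultimately show ?thesis using LIMSEQ_unique[of "\<lambda>k. cpoly_eval q (X k)"] by simp
  qed
  then show ?thesis using torus by (intro that[OF r dq]) auto
qed

text \<open>At torus points near \<open>w\<close> where the denominator does not vanish, its slices
  are nonzero. A normalised limit of these slices gives the fraction for \<open>w\<close>, and the
  degree bound on the numerator survives the limit.\<close>

lemma rational_inner_slice:
  fixes f :: "complex ^ 'n::finite \<Rightarrow> complex"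
  assumes f: "f \<in> rational_inner N" and w: "\<And>i. norm (w $ i) = 1"
  obtains q r where "r \<noteq> 0" "degree q < N" "\<forall>z. norm z = 1 \<longrightarrow> norm (poly q z) = norm (poly r z)"
    "\<forall>z. norm z < 1 \<longrightarrow> f (z *s w) * poly r z = poly q z"
proof -
  obtain q0 r0 where r0: "r0 \<noteq> 0" "total_degree q0 < N"
    and torus: "\<forall>x. (\<forall>i. norm (x $ i) = 1) \<longrightarrow> norm (cpoly_eval q0 x) = norm (cpoly_eval r0 x)"
    and frac: "\<forall>x\<in>polydisc. f x * cpoly_eval r0 x = cpoly_eval q0 x"
    by (rule rational_inner_fraction[OF f])
  have "w $ i islimpt sphere 0 1" for i using w by (rule islimpt_sphere)
  then obtain X where X: "\<And>k i. X k $ i \<in> sphere 0 1" "\<And>k. cpoly_eval r0 (X k) \<noteq> 0" "X \<longlonglongrightarrow> w"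
    using cpoly_nonzero_sequence[OF r0(1), of w "\<lambda>_. sphere 0 1"] by metis
  have nX: "norm (X k $ i) = 1" for k i using X(1) by simp
  \<comment> \<open>The value of this slice at 1 is the denominator at \<open>X k\<close>.\<close>
  have nonzero: "slice_poly r0 (X k) \<noteq> 0" for k
    using X(2)[of k] poly_slice_poly[of r0 "X k" 1] by auto
  have bdry: "norm (poly (slice_poly q0 (X k)) z) = norm (poly (slice_poly r0 (X k)) z)" if "norm z = 1" for k z
    unfolding poly_slice_poly by (rule torus[rule_format]) (use that nX in \<open>simp add: norm_mult\<close>)
  obtain q r \<sigma> s where qr: "degree q \<le> total_degree q0" "r \<noteq> 0"
    "\<forall>z. norm z = 1 \<longrightarrow> norm (poly q z) = norm (poly r z)"
    and \<sigma>: "strict_mono (\<sigma> :: nat \<Rightarrow> nat)"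
    and lim: "\<forall>z. (\<lambda>k. s k * poly (slice_poly q0 (X (\<sigma> k))) z) \<longlonglongrightarrow> poly q z"
      "\<forall>z. (\<lambda>k. s k * poly (slice_poly r0 (X (\<sigma> k))) z) \<longlonglongrightarrow> poly r z"
    by (rule normalised_poly_pair_subsequence[of "\<lambda>k. slice_poly q0 (X k)" "total_degree q0"
        "\<lambda>k. slice_poly r0 (X k)" "total_degree r0", OF degree_slice_poly_le degree_slice_poly_le nonzero bdry])
  have "f (z *s w) * poly r z = poly q z" if z: "norm z < 1" for z
  proof -
    have pX: "z *s X (\<sigma> k) \<in> polydisc" for k by (rule slice_mem_polydisc[OF nX z])
    have pw: "z *s w \<in> polydisc" by (rule slice_mem_polydisc[OF w z])
    have "(\<lambda>k. X (\<sigma> k) $ i) \<longlonglongrightarrow> w $ i" for i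
      using LIMSEQ_subseq_LIMSEQ[OF X(3) \<sigma>] by (intro tendsto_vec_nth) (simp add: o_def)
    then have "(\<lambda>k. z *s X (\<sigma> k)) \<longlonglongrightarrow> z *s w"
      by (intro vec_tendstoI) (simp only: vector_smult_component, intro tendsto_mult tendsto_const)
    moreover have "continuous_on polydisc f"
      using f by (auto simp: rational_inner_def inner_function_def intro: analytic_several_on_continuous_on)
    ultimately have "(\<lambda>k. f (z *s X (\<sigma> k))) \<longlonglongrightarrow> f (z *s w)"
      using pX pw by (auto simp: continuous_on_sequentially o_def)
    \<comment> \<open>Numerator and denominator carry the same scalar \<open>s k\<close>, so the
      relation between them is unaffected by the normalisation.\<close>
    then have "(\<lambda>k. f (z *s X (\<sigma> k)) * (s k * poly (slice_poly r0 (X (\<sigma> k))) z)) \<longlonglongrightarrow> f (z *s w) * poly r z"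
      by (intro tendsto_mult lim[rule_format])
    moreover have "f (z *s X (\<sigma> k)) * (s k * poly (slice_poly r0 (X (\<sigma> k))) z) = s k * poly (slice_poly q0 (X (\<sigma> k))) z" for k
      using frac pX[of k] by (simp add: poly_slice_poly mult_ac)
    ultimately show ?thesis using LIMSEQ_unique[OF _ lim(1)[rule_format, of z]] by simp
  qed
  then show ?thesis using qr r0(2) by (intro that[of r q]) auto
qed

subsection \<open>Freeing a coordinate\<close>

text \<open>Multiplying the factorisation by \<open>r\<close> brings it into the form of
  \<open>inner_rigidity\<close>, with the product of \<open>\<eta>\<close> and \<open>r\<close> as
  cofactor. The cofactor vanishes, and so does \<open>\<eta>\<close> away from the finitely many
  zeros of \<open>r\<close>.\<close>

lemma rational_inner_slice_unique:
  fixes f g :: "complex ^ 'n::finite \<Rightarrow> complex"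
  assumes f: "f \<in> rational_inner N" and g: "g \<in> schur_class" and w: "\<And>i. norm (w $ i) = 1"
    and I: "card I = N" and nodes: "\<And>i. i \<in> I \<Longrightarrow> norm (\<kappa> i) < 1"
    and \<eta>: "\<eta> holomorphic_on ball 0 1"
    and eq: "\<And>z. norm z < 1 \<Longrightarrow> g (z *s w) - f (z *s w) = (\<Prod>i\<in>I. z - \<kappa> i) * \<eta> z"
    and z: "norm z < 1"
  shows "g (z *s w) = f (z *s w)"
proof -
  obtain q r where r0: "r \<noteq> 0" and q: "degree q < N"
    and bdry: "\<forall>z. norm z = 1 \<longrightarrow> norm (poly q z) = norm (poly r z)"
    and frac: "\<forall>z. norm z < 1 \<longrightarrow> f (z *s w) * poly r z = poly q z"
    by (rule rational_inner_slice[OF f w])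
  have zero: "\<eta> z * poly r z = 0" if z: "norm z < 1" for z
  proof (rule inner_rigidity[where q = q and r = r and G = "\<lambda>z. g (z *s w)" and I = I and \<kappa> = \<kappa>
        and \<psi> = "\<lambda>z. \<eta> z * poly r z" and w = z])
    show "degree q < card I" using q I by simp
    show "norm (g (z *s w)) \<le> 1" if "norm z < 1" for z
    proof -
      have "g (z *s w) \<in> ball 0 1"
        using g slice_mem_polydisc[OF w that] by (auto simp: schur_class_def)
      then show ?thesis by simp
    qed
    show "(\<lambda>z. \<eta> z * poly r z) holomorphic_on ball 0 1" by (intro holomorphic_intros \<eta>)
    show "g (z *s w) * poly r z - poly q z = (\<Prod>i\<in>I. z - \<kappa> i) * (\<eta> z * poly r z)" if "norm z < 1" for z
    proof -
      have "g (z *s w) * poly r z - poly q z = (g (z *s w) - f (z *s w)) * poly r z"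
        using frac that by (simp add: algebra_simps)
      then show ?thesis using eq[OF that] by simp
    qed
  qed (use bdry nodes z in auto)
  define U where "U = ball (0::complex) 1 - {z. poly r z = 0}"
  have finr: "finite {z. poly r z = 0}" using r0 by (rule poly_roots_finite)
  \<comment> \<open>The identity theorem covers the zeros of \<open>r\<close> as well.\<close>
  have "\<eta> z = 0"
  proof (rule analytic_continuation_open[of U "ball 0 1" \<eta> "\<lambda>_. 0"])
    show "open U" unfolding U_def by (intro open_Diff finite_imp_closed finr open_ball)
    have "infinite (ball (0::complex) 1)"
      using islimpt_finite[of "ball (0::complex) 1" 0] by (auto simp: islimpt_ball)
    then show "U \<noteq> {}" unfolding U_def using finite_subset[OF _ finr] by blast
    show "\<eta> u = 0" if "u \<in> U" for u using zero[of u] that by (auto simp: U_def)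
  qed (use \<eta> z in \<open>auto simp: U_def\<close>)
  then show ?thesis using eq[OF z] by simp
qed

text \<open>A bound by a positive power forces \<open>F 0 = 0\<close>; dividing out one factor
  \<open>z\<close> lowers the exponent in the bound by one and keeps \<open>C\<close>.\<close>

lemma holomorphic_factor_power_of_bound:
  fixes F :: "complex \<Rightarrow> complex"
  assumes "F holomorphic_on A" "open A" "0 \<in> A" "\<delta> > 0"
    "\<And>z. z \<noteq> 0 \<Longrightarrow> norm z < \<delta> \<Longrightarrow> norm (F z) \<le> C * norm z ^ N"
  shows "\<exists>H. H holomorphic_on A \<and> (\<forall>z\<in>A. F z = z ^ N * H z)"
  using assms
proof (induction N arbitrary: F \<delta>)
  case 0
  then show ?case by auto
next
  case (Suc N)
  have "isCont F 0"
    using Suc.prems(1-3) by (meson continuous_on_eq_continuous_at holomorphic_on_imp_continuous_on)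
  then have lim: "(F \<longlongrightarrow> F 0) (at 0)" by (simp add: isCont_def)
  have "((\<lambda>z::complex. C * norm z ^ Suc N) \<longlongrightarrow> C * norm (0::complex) ^ Suc N) (at 0)"
    by (rule tendsto_mult[OF tendsto_const tendsto_power[OF tendsto_norm[OF tendsto_ident_at]]])
  then have "((\<lambda>z::complex. C * norm z ^ Suc N) \<longlongrightarrow> 0) (at 0)" by simp
  moreover have "\<forall>\<^sub>F z in at 0. norm (F z) \<le> C * norm z ^ Suc N"
    unfolding eventually_at using Suc.prems(4,5) by (intro exI[of _ \<delta>]) auto
  ultimately have "(F \<longlongrightarrow> 0) (at 0)" by (rule Lim_null_comparison[rotated])
  with lim have F0: "F 0 = 0" using tendsto_unique[of "at (0::complex)"] by auto
  obtain H where H: "H holomorphic_on A" "\<And>z. z \<in> A \<Longrightarrow> F z = (\<Prod>a\<in>{0}. z - a) * H z"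
    by (rule holomorphic_factor_zeros[of "{0}" A F]) (use Suc.prems F0 in auto)
  obtain \<epsilon> where \<epsilon>: "\<epsilon> > 0" "ball 0 \<epsilon> \<subseteq> A" using Suc.prems(2,3) open_contains_ball by blast
  have "norm (H z) \<le> C * norm z ^ N" if "z \<noteq> 0" "norm z < min \<delta> \<epsilon>" for z
  proof -
    have "z \<in> A" using that \<epsilon>(2) by auto
    then have "norm z * norm (H z) \<le> norm z * (C * norm z ^ N)"
      using Suc.prems(5)[of z] that H(2)[of z] by (simp add: norm_mult mult_ac)
    then show ?thesis using that by simp
  qed
  then obtain K where K: "K holomorphic_on A" "\<forall>z\<in>A. H z = z ^ N * K z"
    using Suc.IH[OF H(1) Suc.prems(2,3), of "min \<delta> \<epsilon>"] Suc.prems(4) \<epsilon>(1) by auto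
  then show ?case using H(2) by (intro exI[of _ K]) auto
qed

text \<open>A Schwarz lemma with several zeros: on the circle of radius 1/2 every factor has modulus
  at least 1/4, so the quotient by all of them is at most \<open>C * 4 ^ card S\<close> there, and
  inside by the maximum principle.\<close>

lemma bound_of_zeros:
  fixes F :: "complex \<Rightarrow> complex"
  assumes F: "F holomorphic_on ball 0 1" and bd: "\<And>u. norm u = 1/2 \<Longrightarrow> norm (F u) \<le> C"
    and S: "finite S" "\<And>s. s \<in> S \<Longrightarrow> norm s \<le> 1/4" "\<And>s. s \<in> S \<Longrightarrow> F s = 0"
    and u: "norm u \<le> 1/2"
  shows "norm (F u) \<le> C * 4 ^ card S * (\<Prod>s\<in>S. norm (u - s))"
proof -
  obtain H where H: "H holomorphic_on ball 0 1" "\<And>z. z \<in> ball 0 1 \<Longrightarrow> F z = (\<Prod>a\<in>S. z - a) * H z"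
    by (rule holomorphic_factor_zeros[of S "ball 0 1" F]) (use F S in force)+
  have "norm (H u) \<le> C * 4 ^ card S"
  proof (rule maximum_modulus_frontier[of H "cball 0 (1/2)"])
    show "H holomorphic_on interior (cball 0 (1/2))"
      by (rule holomorphic_on_subset[OF H(1)]) auto
    show "continuous_on (closure (cball 0 (1/2))) H"
      by (rule continuous_on_subset[OF holomorphic_on_imp_continuous_on[OF H(1)]]) auto
    fix z :: complex assume "z \<in> frontier (cball 0 (1/2))"
    then have z: "norm z = 1/2" by simp
    have "norm (z - s) \<ge> 1/4" if "s \<in> S" for s
      using norm_triangle_ineq2[of z s] z S(2)[OF that] by linarith
    then have "(\<Prod>s\<in>S. 1/4) \<le> (\<Prod>s\<in>S. norm (z - s))" by (intro prod_mono) auto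
    then have ge: "(1/4) ^ card S \<le> (\<Prod>s\<in>S. norm (z - s))" by simp
    have "(1/4) ^ card S * norm (H z) \<le> (\<Prod>s\<in>S. norm (z - s)) * norm (H z)"
      using ge by (rule mult_right_mono) simp
    also have "\<dots> = norm (F z)" using H(2)[of z] z by (simp add: norm_mult prod_norm)
    also have "\<dots> \<le> C" by (rule bd[OF z])
    finally show "norm (H z) \<le> C * 4 ^ card S" by (simp add: power_one_over field_simps)
  qed (use u in auto)
  then have "(\<Prod>s\<in>S. norm (u - s)) * norm (H u) \<le> (\<Prod>s\<in>S. norm (u - s)) * (C * 4 ^ card S)"
    by (intro mult_left_mono prod_nonneg) auto
  then show ?thesis using H(2)[of u] u by (simp add: norm_mult prod_norm mult_ac)
qed

text \<open>For fixed small \<open>z\<close>, \<open>g - f\<close> as a function of coordinate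
  \<open>j\<close> vanishes at the \<open>N\<close> points \<open>z * t\<close>, and
  \<open>z * w $ j\<close> is within \<open>2 * norm z\<close> of each. So the slice along
  \<open>w\<close> has a zero of order at least \<open>N\<close> at the origin.\<close>

lemma rational_inner_free_coord:
  fixes f g :: "complex ^ 'n::finite \<Rightarrow> complex"
  assumes f: "f \<in> rational_inner N" and g: "g \<in> schur_class" and w: "\<And>i. norm (w $ i) = 1"
    and T: "card T = N" "finite T" "T \<subseteq> sphere 0 1"
    and eq: "\<And>t z. t \<in> T \<Longrightarrow> norm z < 1 \<Longrightarrow> g (z *s replace_coord j w t) = f (z *s replace_coord j w t)"
    and z: "norm z < 1"
  shows "g (z *s w) = f (z *s w)"
proof -
  define h where "h = (\<lambda>x. g x - f x)"
  have h: "analytic_several_on h polydisc"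
    unfolding h_def using f g
    by (intro analytic_several_on_diff) (auto simp: schur_class_def rational_inner_def inner_function_def)
  \<comment> \<open>One compact polydisc gives a bound \<open>C\<close> that serves all small
    \<open>z\<close>.\<close>
  define B where "B = {x :: complex ^ 'n. \<forall>i. x $ i \<in> cball 0 (1/2)}"
  have "compact B"
    unfolding compact_eq_bounded_closed
  proof
    show "bounded B"
    proof (rule boundedI)
      fix x assume x: "x \<in> B"
      have "norm x \<le> (\<Sum>i\<in>UNIV. norm (x $ i))" unfolding norm_vec_def by (rule L2_set_le_sum) simp
      also have "\<dots> \<le> (\<Sum>i\<in>(UNIV :: 'n set). 1/2)" by (rule sum_mono) (use x in \<open>simp add: B_def\<close>)
      finally show "norm x \<le> real CARD('n) * (1/2)" by simp
    qed
    have "B = (\<Inter>i. (\<lambda>x. x $ i) -` cball 0 (1/2))" by (auto simp: B_def)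
    then show "closed B"
      by (auto intro!: closed_INT continuous_closed_vimage continuous_intros)
  qed
  moreover have "B \<subseteq> polydisc"
  proof
    fix x assume "x \<in> B"
    then have "norm (x $ i) \<le> 1/2" for i by (simp add: B_def)
    then have "norm (x $ i) < 1" for i by (rule le_less_trans) simp
    then show "x \<in> polydisc" by (simp add: polydisc_def)
  qed
  ultimately have "compact (h ` B)"
    by (intro compact_continuous_image continuous_on_subset[OF analytic_several_on_continuous_on[OF h]])
  then have "bounded (h ` B)" by (rule compact_imp_bounded)
  then obtain C where C: "\<And>x. x \<in> B \<Longrightarrow> norm (h x) \<le> C"
    by (auto simp: bounded_iff)
  \<comment> \<open>For \<open>norm z < 1/4\<close> the zeros \<open>z * t\<close> have the size
    required in \<open>bound_of_zeros\<close>, and the points where \<open>h\<close> is estimated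
    lie in \<open>B\<close>.\<close>
  have bound: "norm (h (z *s w)) \<le> (C * 8 ^ N) * norm z ^ N" if z: "z \<noteq> 0" "norm z < 1/4" for z
  proof -
    define F where "F = (\<lambda>u. h (replace_coord j (z *s w) u))"
    have coord: "replace_coord j (z *s w) (z * u) = z *s replace_coord j w u" for u
      by (simp add: replace_coord_def vec_eq_iff)
    have "norm (F (z * w $ j)) \<le> C * 4 ^ card ((*) z ` T) * (\<Prod>s\<in>(*) z ` T. norm (z * w $ j - s))"
    proof (rule bound_of_zeros)
      show "F holomorphic_on ball 0 1"
        unfolding F_def by (rule analytic_several_on_coord_holomorphic[OF h]) (use z w in \<open>simp add: norm_mult\<close>)
      show "norm (F u) \<le> C" if "norm u = 1/2" for u
        unfolding F_def by (rule C) (use that z w in \<open>auto simp: B_def replace_coord_def norm_mult\<close>)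
      show "F s = 0" if "s \<in> (*) z ` T" for s
        using that eq z by (auto simp: F_def coord h_def)
    qed (use T z w in \<open>auto simp: norm_mult subset_iff\<close>)
    also have "card ((*) z ` T) = N" using z T by (subst card_image) (auto simp: inj_on_def)
    also have "(\<Prod>s\<in>(*) z ` T. norm (z * w $ j - s)) = (\<Prod>t\<in>T. norm (z * w $ j - z * t))"
      using z by (subst prod.reindex) (auto simp: inj_on_def)
    also have "\<dots> = norm z ^ N * (\<Prod>t\<in>T. norm (w $ j - t))"
      unfolding right_diff_distrib[symmetric] norm_mult prod.distrib using T by simp
    \<comment> \<open>Two points of the unit circle are at distance at most 2.\<close>
    also have "C * 4 ^ N * (norm z ^ N * (\<Prod>t\<in>T. norm (w $ j - t))) \<le> C * 4 ^ N * (norm z ^ N * 2 ^ N)"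
    proof -
      have "0 \<in> B" by (simp add: B_def)
      from order_trans[OF norm_ge_zero C[OF this]] have "C \<ge> 0" .
      moreover have "(\<Prod>t\<in>T. norm (w $ j - t)) \<le> (\<Prod>t\<in>T. 2)"
      proof (rule prod_mono)
        fix t assume "t \<in> T"
        then have "norm t = 1" using T by auto
        then show "0 \<le> norm (w $ j - t) \<and> norm (w $ j - t) \<le> 2"
          using norm_triangle_ineq4[of "w $ j" t] w[of j] by simp
      qed
      ultimately show ?thesis using T by (intro mult_left_mono) auto
    qed
    also have "\<dots> = (C * 8 ^ N) * norm z ^ N"
    proof -
      have "(4::real) ^ N * 2 ^ N = 8 ^ N" by (simp flip: power_mult_distrib)
      then show ?thesis by (metis mult.assoc mult.commute)
    qed
    also have "F (z * w $ j) = h (z *s w)"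
      unfolding F_def by (rule arg_cong[of _ _ h]) (simp add: replace_coord_def vec_eq_iff)
    finally show ?thesis .
  qed
  have "\<exists>\<eta>. \<eta> holomorphic_on ball 0 1 \<and> (\<forall>z\<in>ball 0 1. h (z *s w) = z ^ N * \<eta> z)"
  proof (rule holomorphic_factor_power_of_bound)
    show "(\<lambda>z. h (z *s w)) holomorphic_on ball 0 1"
      by (rule analytic_several_on_slice_holomorphic[OF h w])
    show "(0::real) < 1/4" by simp
  qed (use bound in auto)
  then obtain \<eta> where \<eta>: "\<eta> holomorphic_on ball 0 1" "\<forall>z\<in>ball 0 1. h (z *s w) = z ^ N * \<eta> z"
    by blast
  \<comment> \<open>All \<open>N\<close> nodes are taken at 0, so the product over
    \<open>{..<N}\<close> is \<open>z ^ N\<close>.\<close>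
  show ?thesis
    by (rule rational_inner_slice_unique[OF f g w, of "{..<N}" "\<lambda>_. 0" \<eta>])
       (use \<eta> z in \<open>auto simp: h_def\<close>)
qed

text \<open>The maximum principle is applied in one coordinate after another; \<open>A\<close> holds
  the coordinates already allowed to move from the circle of radius \<open>\<rho>\<close> into the
  disc.\<close>

lemma analytic_eq_0_polydisc:
  fixes h :: "complex ^ 'n::finite \<Rightarrow> complex"
  assumes h: "analytic_several_on h polydisc"
    and zero: "\<And>x. (\<And>i. norm (x $ i) = \<rho>) \<Longrightarrow> h x = 0"
    and \<rho>: "\<rho> < 1" and x: "\<And>i. norm (x $ i) \<le> \<rho>"
  shows "h x = 0"
proof -
  have "\<forall>x. (\<forall>i. norm (x $ i) \<le> \<rho>) \<and> (\<forall>i. i \<notin> A \<longrightarrow> norm (x $ i) = \<rho>) \<longrightarrow> h x = 0" if "finite A" for A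
    using that
  proof (induction A rule: finite_induct)
    case empty
    then show ?case using zero by auto
  next
    case (insert j A)
    show ?case
    proof (intro allI impI)
      fix x :: "complex ^ 'n"
      assume x: "(\<forall>i. norm (x $ i) \<le> \<rho>) \<and> (\<forall>i. i \<notin> insert j A \<longrightarrow> norm (x $ i) = \<rho>)"
      define F where "F = (\<lambda>u. h (replace_coord j x u))"
      have F: "F holomorphic_on ball 0 1"
        unfolding F_def
        by (rule analytic_several_on_coord_holomorphic[OF h]) (use x \<rho> in \<open>auto intro: le_less_trans\<close>)
      have "norm (F (x $ j)) \<le> 0"
      proof (rule maximum_modulus_frontier[of F "cball 0 \<rho>"])
        show "F holomorphic_on interior (cball 0 \<rho>)"
          by (rule holomorphic_on_subset[OF F]) (use \<rho> in auto)
        show "continuous_on (closure (cball 0 \<rho>)) F"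
          by (rule continuous_on_subset[OF holomorphic_on_imp_continuous_on[OF F]]) (use \<rho> in auto)
        fix u :: complex assume "u \<in> frontier (cball 0 \<rho>)"
        then have "norm u = \<rho>" by simp
        then have "h (replace_coord j x u) = 0"
          using insert.IH x by (auto simp: replace_coord_def)
        then show "norm (F u) \<le> 0" by (simp add: F_def)
      qed (use x in auto)
      moreover have "replace_coord j x (x $ j) = x" by (simp add: replace_coord_def vec_eq_iff)
      ultimately show "h x = 0" by (simp add: F_def)
    qed
  qed
  from this[of UNIV] x show ?thesis by auto
qed

subsection \<open>Determining families\<close>

text \<open>With \<open>w $ a = 1\<close> and the other coordinates of \<open>w\<close> in the grid,
  the slice along \<open>w\<close> is one of the given discs. The other coordinates are then freed
  one at a time.\<close>

lemma grid_determining: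
  fixes N :: nat and a :: "'n::finite" and \<tau> :: "'n \<Rightarrow> nat \<Rightarrow> complex" and p :: "nat \<Rightarrow> nat \<Rightarrow> complex ^ 'n"
  assumes \<tau>: "\<And>r. r \<noteq> a \<Longrightarrow> \<tau> r ` {1..N} \<subseteq> sphere 0 1 \<and> inj_on (\<tau> r) {1..N}"
    and idx: "bij_betw idx {1..M} (PiE (UNIV - {a}) (\<lambda>_. {1..N}))"
    and p: "\<And>k. k \<in> {1..M} \<Longrightarrow> inj_on (p k) {1..N} \<and>
               p k ` {1..N} \<subseteq> analytic_disc a (\<lambda>r. \<tau> r (idx k r)) ` ball 0 1"
  shows "determining N ({1..M} \<times> {1..N}) (\<lambda>(k, j). p k j)"
  unfolding determining_def
proof (intro ballI impI)
  fix f g :: "complex ^ 'n \<Rightarrow> complex" and x :: "complex ^ 'n"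
  assume f: "f \<in> rational_inner N" and g: "g \<in> schur_class"
    and eq: "\<forall>i\<in>{1..M} \<times> {1..N}. g (case i of (k, j) \<Rightarrow> p k j) = f (case i of (k, j) \<Rightarrow> p k j)"
    and x: "x \<in> polydisc"
  have fg: "g (p k j) = f (p k j)" if "k \<in> {1..M}" "j \<in> {1..N}" for k j
    using eq that by force
  define h where "h = (\<lambda>x. g x - f x)"
  have h: "analytic_several_on h polydisc"
    unfolding h_def using f g
    by (intro analytic_several_on_diff) (auto simp: schur_class_def rational_inner_def inner_function_def)
  \<comment> \<open>\<open>A\<close> holds the coordinates already free to range over the
    circle.\<close>
  have grid: "\<forall>w z. (\<forall>i. norm (w $ i) = 1) \<and> w $ a = 1 \<and> (\<forall>i. i \<notin> A \<and> i \<noteq> a \<longrightarrow> w $ i \<in> \<tau> i ` {1..N})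
      \<and> norm z < 1 \<longrightarrow> g (z *s w) = f (z *s w)" if "finite A" "a \<notin> A" for A
    using that
  proof (induction A rule: finite_induct)
    case empty
    show ?case
    proof (intro allI impI, elim conjE)
      fix w :: "complex ^ 'n" and z :: complex
      assume w: "\<forall>i. norm (w $ i) = 1" "w $ a = 1" "\<forall>i. i \<notin> {} \<and> i \<noteq> a \<longrightarrow> w $ i \<in> \<tau> i ` {1..N}"
        and z: "norm z < 1"
      have "\<forall>i. \<exists>n. i \<noteq> a \<longrightarrow> n \<in> {1..N} \<and> w $ i = \<tau> i n" using w(3) by blast
      from choice[OF this] obtain e where e: "\<And>i. i \<noteq> a \<Longrightarrow> e i \<in> {1..N} \<and> w $ i = \<tau> i (e i)" by blast
      \<comment> \<open>Members of \<open>PiE\<close> take the value \<open>undefined\<close> off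
        their domain, hence the restriction.\<close>
      have "restrict e (UNIV - {a}) \<in> PiE (UNIV - {a}) (\<lambda>_. {1..N})" using e by auto
      then have "restrict e (UNIV - {a}) \<in> idx ` {1..M}" using bij_betw_imp_surj_on[OF idx] by simp
      then obtain k where k: "k \<in> {1..M}" "idx k = restrict e (UNIV - {a})"
        by (elim imageE) simp
      have disc: "analytic_disc a (\<lambda>r. \<tau> r (idx k r)) z = z *s w" for z
        using e w(2) by (auto simp: analytic_disc_def vec_eq_iff k(2))
      \<comment> \<open>Since \<open>w $ a = 1\<close>, coordinate \<open>a\<close> of a point of
        the disc is its parameter, so distinct points give \<open>N\<close> distinct
        parameters.\<close>
      define Z where "Z = (\<lambda>y. y $ a) ` p k ` {1..N}"
      have pk: "\<exists>u\<in>ball 0 1. p k j = u *s w" if "j \<in> {1..N}" for j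
      proof -
        have "p k j \<in> (\<lambda>z. z *s w) ` ball 0 1" using p[OF k(1)] that unfolding disc by blast
        then show ?thesis by blast
      qed
      have "inj_on (\<lambda>y. y $ a) (p k ` {1..N})"
      proof (rule inj_onI)
        fix y y' assume "y \<in> p k ` {1..N}" "y' \<in> p k ` {1..N}" and yy: "y $ a = y' $ a"
        then obtain u u' where "y = u *s w" "y' = u' *s w" using pk by blast
        then show "y = y'" using yy w(2) by simp
      qed
      then have cardZ: "card Z = N"
        using p[OF k(1)] by (simp add: Z_def card_image)
      have Z: "norm u < 1 \<and> h (u *s w) = 0" if "u \<in> Z" for u
      proof -
        obtain j where j: "j \<in> {1..N}" "u = p k j $ a" using \<open>u \<in> Z\<close> by (auto simp: Z_def)
        obtain v where "v \<in> ball 0 1" "p k j = v *s w" using pk[OF j(1)] by blast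
        then show ?thesis using j(2) w(2) fg[OF k(1) j(1)] by (simp add: h_def)
      qed
      obtain \<eta> where \<eta>: "\<eta> holomorphic_on ball 0 1"
        "\<And>z. z \<in> ball 0 1 \<Longrightarrow> h (z *s w) = (\<Prod>u\<in>Z. z - u) * \<eta> z"
        by (rule holomorphic_factor_zeros[of Z "ball 0 1" "\<lambda>z. h (z *s w)"])
           (use Z analytic_several_on_slice_holomorphic[OF h] w in \<open>auto simp: Z_def\<close>)
      show "g (z *s w) = f (z *s w)"
        by (rule rational_inner_slice_unique[OF f g _ cardZ, of w "\<lambda>u. u" \<eta>])
           (use w Z \<eta> z in \<open>auto simp: h_def\<close>)
    qed
  next
    case (insert j A)
    show ?case
    proof (intro allI impI, elim conjE)
      fix w :: "complex ^ 'n" and z :: complex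
      assume w: "\<forall>i. norm (w $ i) = 1" "w $ a = 1" "\<forall>i. i \<notin> insert j A \<and> i \<noteq> a \<longrightarrow> w $ i \<in> \<tau> i ` {1..N}"
        and z: "norm z < 1"
      have j: "j \<noteq> a" using insert by auto
      show "g (z *s w) = f (z *s w)"
      proof (rule rational_inner_free_coord[OF f g, of w "\<tau> j ` {1..N}" j])
        show "card (\<tau> j ` {1..N}) = N" using \<tau>[OF j] by (simp add: card_image)
        show "\<tau> j ` {1..N} \<subseteq> sphere 0 1" using \<tau>[OF j] by blast
        fix t z :: complex assume t: "t \<in> \<tau> j ` {1..N}" and z: "norm z < 1"
        then have "norm t = 1" using \<tau>[OF j] by auto
        then have "(\<forall>i. norm (replace_coord j w t $ i) = 1) \<and> replace_coord j w t $ a = 1 \<and>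
            (\<forall>i. i \<notin> A \<and> i \<noteq> a \<longrightarrow> replace_coord j w t $ i \<in> \<tau> i ` {1..N}) \<and> norm z < 1"
          using w t z j by (auto simp: replace_coord_def)
        then show "g (z *s replace_coord j w t) = f (z *s replace_coord j w t)"
          using insert.IH insert.prems by blast
      qed (use w z in auto)
    qed
  qed
  \<comment> \<open>With the largest modulus as radius, \<open>x\<close> lies in a closed polydisc
    of equal radii whose distinguished boundary is covered by the slices in
    \<open>grid\<close>.\<close>
  define \<rho> where "\<rho> = Max (range (\<lambda>i. norm (x $ i)))"
  have "h x = 0"
  proof (rule analytic_eq_0_polydisc[OF h])
    show "\<rho> < 1" using x by (auto simp: \<rho>_def polydisc_def)
    show "norm (x $ i) \<le> \<rho>" for i unfolding \<rho>_def by (rule Max_ge) auto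
    fix y :: "complex ^ 'n" assume y: "\<And>i. norm (y $ i) = \<rho>"
    show "h y = 0"
    proof -
      \<comment> \<open>If \<open>\<rho> = 0\<close>, then \<open>y\<close> is the origin and the
        quotients would be 0; the vector of ones keeps \<open>w\<close> on the torus.\<close>
      define w :: "complex ^ 'n" where "w = (\<chi> i. if \<rho> = 0 then 1 else y $ i / y $ a)"
      have ya: "y $ a = 0 \<longleftrightarrow> \<rho> = 0" using y[of a] by auto
      have "y = y $ a *s w"
        using y ya by (auto simp: w_def vec_eq_iff)
      moreover have "g (y $ a *s w) = f (y $ a *s w)"
      proof (rule grid[of "UNIV - {a}", rule_format])
        show "(\<forall>i. norm (w $ i) = 1) \<and> w $ a = 1 \<and> (\<forall>i. i \<notin> UNIV - {a} \<and> i \<noteq> a \<longrightarrow> w $ i \<in> \<tau> i ` {1..N})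
            \<and> norm (y $ a) < 1"
          using y ya \<open>\<rho> < 1\<close> by (auto simp: w_def norm_divide)
      qed auto
      ultimately show ?thesis by (simp add: h_def)
    qed
  qed
  then show "g x = f x" by (simp add: h_def)
qed

text \<open>One set of \<open>N\<close> points of the circle serves every coordinate, and the same
  \<open>N\<close> parameters serve every disc; a bijection turns the pairs of indices into a single
  list.\<close>

lemma exists_determining_family:
  fixes a :: "'n::finite"
  obtains p :: "nat \<Rightarrow> complex ^ 'n"
  where "\<forall>i\<in>{1..N ^ CARD('n)}. p i \<in> polydisc" "determining N {1..N ^ CARD('n)} p"
proof -
  define M where "M = N ^ (CARD('n) - 1)"
  have "infinite (sphere (0::complex) 1)"
    using infinite_unit_circle by (simp add: sphere_def dist_norm)
  then obtain T where T: "T \<subseteq> sphere (0::complex) 1" "card T = N" "finite T"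
    using infinite_arbitrarily_large by metis
  then obtain e where e: "bij_betw e {1..N} T"
    using ex_bij_betw_nat_finite_1[of T] by auto
  define P where "P = (PiE (UNIV - {a}) (\<lambda>_. {1..N}) :: ('n \<Rightarrow> nat) set)"
  have "card P = M" "finite P"
    by (auto simp: P_def M_def card_PiE intro!: finite_PiE)
  then obtain idx where idx: "bij_betw idx {1..M} P"
    using ex_bij_betw_nat_finite_1[of P] by auto
  \<comment> \<open>Dividing by \<open>N + 1\<close> rather than \<open>N\<close> keeps the
    parameter for \<open>j = N\<close> inside the open disc.\<close>
  define u where "u = (\<lambda>j. complex_of_real (real j / real (Suc N)))"
  have nu: "norm (u j) < 1" if "j \<in> {1..N}" for j
    using that unfolding u_def norm_of_real by simp
  define p where "p = (\<lambda>k j. analytic_disc a (\<lambda>r. e (idx k r)) (u j))"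
  have nT: "norm (e i) = 1" if "i \<in> {1..N}" for i
    using bij_betwE[OF e] T(1) that by fastforce
  have det: "determining N ({1..M} \<times> {1..N}) (\<lambda>(k, j). p k j)"
  proof (rule grid_determining[where \<tau> = "\<lambda>_. e" and a = a])
    show "e ` {1..N} \<subseteq> sphere 0 1 \<and> inj_on e {1..N}" for r
      using e T by (auto simp: bij_betw_def)
    show "bij_betw idx {1..M} (PiE (UNIV - {a}) (\<lambda>_. {1..N}))" using idx by (simp add: P_def)
    fix k assume "k \<in> {1..M}"
    have "inj_on (p k) {1..N}"
    proof (rule inj_onI)
      fix i j assume "p k i = p k j"
      then have "p k i $ a = p k j $ a" by simp
      then have "real i / real (Suc N) = real j / real (Suc N)"
        unfolding p_def analytic_disc_def u_def vec_lambda_beta by (simp only: of_real_eq_iff simp_thms if_True)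
      then show "i = j" by simp
    qed
    then show "inj_on (p k) {1..N} \<and> p k ` {1..N} \<subseteq> analytic_disc a (\<lambda>r. e (idx k r)) ` ball 0 1"
      using nu by (auto simp: p_def)
  qed
  have mem: "p k j \<in> polydisc" if "k \<in> {1..M}" "j \<in> {1..N}" for k j
  proof -
    have "idx k \<in> P" using bij_betwE[OF idx] that(1) by blast
    then have "norm (e (idx k r)) = 1" if "r \<noteq> a" for r
      using PiE_mem[of "idx k" "UNIV - {a}" "\<lambda>_. {1..N}" r] that by (intro nT) (simp add: P_def)
    then show ?thesis
      using nu[OF that(2)] by (simp add: p_def analytic_disc_def polydisc_def norm_mult)
  qed
  \<comment> \<open>The subtraction in \<open>CARD('n) - 1\<close> is then a true predecessor, so
    the exponents add up.\<close>
  have "CARD('n) > 0" by simp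
  then have "N ^ CARD('n) = M * N" unfolding M_def by (metis Suc_diff_1 power_Suc2)
  then have "card {1..N ^ CARD('n)} = card ({1..M} \<times> {1..N})" by simp
  then obtain \<beta> where \<beta>: "bij_betw \<beta> {1..N ^ CARD('n)} ({1..M} \<times> {1..N})"
    using finite_same_card_bij[of "{1..N ^ CARD('n)}" "{1..M} \<times> {1..N}"] by auto
  have \<beta>_mem: "fst (\<beta> i) \<in> {1..M} \<and> snd (\<beta> i) \<in> {1..N}" if "i \<in> {1..N ^ CARD('n)}" for i
    using bij_betwE[OF \<beta>] that by (metis mem_Times_iff)
  define p' where "p' = (\<lambda>i. p (fst (\<beta> i)) (snd (\<beta> i)))"
  have "determining N {1..N ^ CARD('n)} p'"
    unfolding determining_def
  proof (intro ballI impI)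
    fix f g :: "complex ^ 'n \<Rightarrow> complex" and z :: "complex ^ 'n"
    assume fg: "f \<in> rational_inner N" "g \<in> schur_class" "z \<in> polydisc"
      and eq: "\<forall>i\<in>{1..N ^ CARD('n)}. g (p' i) = f (p' i)"
    have "g (case b of (k, j) \<Rightarrow> p k j) = f (case b of (k, j) \<Rightarrow> p k j)" if "b \<in> {1..M} \<times> {1..N}" for b
    proof -
      have "b \<in> \<beta> ` {1..N ^ CARD('n)}" using that bij_betw_imp_surj_on[OF \<beta>] by simp
      then obtain i where "b = \<beta> i" "i \<in> {1..N ^ CARD('n)}" by (rule imageE)
      then show ?thesis using eq by (simp add: p'_def case_prod_unfold)
    qed
    then show "g z = f z" using det fg unfolding determining_def by blast
  qed
  moreover have "\<forall>i\<in>{1..N ^ CARD('n)}. p' i \<in> polydisc"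
    using mem \<beta>_mem by (simp add: p'_def)
  ultimately show ?thesis using that by blast
qed

theorem theorem1p1:
  fixes N :: nat and a :: "'n::finite"
  assumes "N \<ge> 1"
  shows "(\<exists>p :: nat \<Rightarrow> complex ^ 'n.
            (\<forall>i\<in>{1..N ^ CARD('n)}. p i \<in> polydisc) \<and> determining N {1..N ^ CARD('n)} p)
       \<and> (\<forall>(\<tau> :: 'n \<Rightarrow> nat \<Rightarrow> complex) (idx :: nat \<Rightarrow> 'n \<Rightarrow> nat) (p :: nat \<Rightarrow> nat \<Rightarrow> complex ^ 'n) M.
            M = N ^ (CARD('n) - 1) \<longrightarrow>
            (\<forall>r. r \<noteq> a \<longrightarrow> \<tau> r ` {1..N} \<subseteq> sphere 0 1 \<and> inj_on (\<tau> r) {1..N}) \<longrightarrow>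
            bij_betw idx {1..M} (PiE (UNIV - {a}) (\<lambda>_. {1..N})) \<longrightarrow>
            (\<forall>k\<in>{1..M}. inj_on (p k) {1..N} \<and>
               p k ` {1..N} \<subseteq> analytic_disc a (\<lambda>r. \<tau> r (idx k r)) ` ball 0 1) \<longrightarrow>
            determining N ({1..M} \<times> {1..N}) (\<lambda>(k, j). p k j))"
proof (rule conjI)
  show "\<exists>p :: nat \<Rightarrow> complex ^ 'n.
      (\<forall>i\<in>{1..N ^ CARD('n)}. p i \<in> polydisc) \<and> determining N {1..N ^ CARD('n)} p"
    by (rule exists_determining_family[of N]) blast
next
  show "\<forall>(\<tau> :: 'n \<Rightarrow> nat \<Rightarrow> complex) (idx :: nat \<Rightarrow> 'n \<Rightarrow> nat) (p :: nat \<Rightarrow> nat \<Rightarrow> complex ^ 'n) M.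
            M = N ^ (CARD('n) - 1) \<longrightarrow>
            (\<forall>r. r \<noteq> a \<longrightarrow> \<tau> r ` {1..N} \<subseteq> sphere 0 1 \<and> inj_on (\<tau> r) {1..N}) \<longrightarrow>
            bij_betw idx {1..M} (PiE (UNIV - {a}) (\<lambda>_. {1..N})) \<longrightarrow>
            (\<forall>k\<in>{1..M}. inj_on (p k) {1..N} \<and>
               p k ` {1..N} \<subseteq> analytic_disc a (\<lambda>r. \<tau> r (idx k r)) ` ball 0 1) \<longrightarrow>
            determining N ({1..M} \<times> {1..N}) (\<lambda>(k, j). p k j)"
  proof (intro allI impI)
    fix \<tau> :: "'n \<Rightarrow> nat \<Rightarrow> complex" and idx :: "nat \<Rightarrow> 'n \<Rightarrow> nat" and p :: "nat \<Rightarrow> nat \<Rightarrow> complex ^ 'n" and M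
    assume "\<forall>r. r \<noteq> a \<longrightarrow> \<tau> r ` {1..N} \<subseteq> sphere 0 1 \<and> inj_on (\<tau> r) {1..N}"
      and "bij_betw idx {1..M} (PiE (UNIV - {a}) (\<lambda>_. {1..N}))"
      and "\<forall>k\<in>{1..M}. inj_on (p k) {1..N} \<and>
               p k ` {1..N} \<subseteq> analytic_disc a (\<lambda>r. \<tau> r (idx k r)) ` ball 0 1"
    then show "determining N ({1..M} \<times> {1..N}) (\<lambda>(k, j). p k j)"
      by (intro grid_determining[where \<tau> = \<tau> and a = a and idx = idx]) simp_all
  qed
qed

end
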